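(* Let $G$ be a locally compact second countable group and let $A$ be a Polish $G$-module. Then for every $p$, every cohomology class in $\mathrm{H}^p_{\mathrm{m}}(G,A)$ has a representative cocycle $\sigma\in\mathcal{Z}^p(G,A)$ which is (given by a Borel map $\sigma:G^p\to A$ that is) locally totally bounded.
   Context: A Polish $G$-module is a Polish Abelian group $A$ with a continuous action $T:G\curvearrowright A$ by continuous automorphisms. A Borel map $f:X\to Y$ from a locally compact space to a Polish space is locally totally bounded if for every compact $K\subseteq X$ the image $f(K)$ is precompact in $Y$. For $p\ge 1$, $\mathcal{C}^p(G,A)$ is the group of Haar-a.e. equivalence classes of Borel maps $G^p\to A$; $\mathcal{C}^0(G,A)=A$, and $\mathcal{C}^{p}(G,A)=(0)$ for $p<0$. The coboundary $d:\mathcal{C}^p(G,A)\to\mathcal{C}^{p+1}(G,A)$ is $$d\phi(g_1,\dots,g_{p+1}) = T^{g_1}\phi(g_2,\dots,g_{p+1})+\sum_{i=1}^p(-1)^i\phi(g_1,\dots,g_ig_{i+1},\dots,g_{p+1})+(-1)^{p+1}\phi(g_1,\dots,g_p)$$ (a.e.). Put $\mathcal{Z}^p(G,A)=\ker d|_{\mathcal{C}^p(G,A)}$, $\mathcal{B}^p(G,A)=d(\mathcal{C}^{p-1}(G,A))$ and $\mathrm{H}^p_{\mathrm{m}}(G,A)=\mathcal{Z}^p(G,A)/\mathcal{B}^p(G,A)$. *)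

theory Defs
  imports "HOL-Analysis.Analysis" "HOL-Algebra.Coset"
begin

text \<open>
  The acting group is written additively, because the topological groups of the library
  (class \<open>topological_group_add\<close>) are; it is not assumed to be commutative. So \<open>g + h\<close> is the
  product of \<open>g\<close> and \<open>h\<close> in the group, and \<open>0\<close> is its identity element.
\<close>

definition polish_module ::
  "('g::topological_group_add \<Rightarrow> 'a::{polish_space, topological_ab_group_add} \<Rightarrow> 'a) \<Rightarrow> bool"
where
  "polish_module T \<longleftrightarrow>
     (\<forall>a. T 0 a = a) \<and>
     (\<forall>g h a. T (g + h) a = T g (T h a)) \<and>
     (\<forall>g a b. T g (a + b) = T g a + T g b) \<and>
     continuous_on UNIV (\<lambda>(g, a). T g a)"

text \<open>On a locally compact second countable Hausdorff group a Borel measure that is finite on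
  compact sets is automatically regular, so regularity is not listed.\<close>

definition left_haar_measure ::
  "'g::{topological_group_add, t2_space, second_countable_topology} measure \<Rightarrow> bool"
where
  "left_haar_measure \<mu> \<longleftrightarrow>
     sets \<mu> = sets borel \<and>
     emeasure \<mu> UNIV \<noteq> 0 \<and>
     (\<forall>K. compact K \<longrightarrow> emeasure \<mu> K < \<infinity>) \<and>
     (\<forall>g. \<forall>B \<in> sets borel. emeasure \<mu> ((+) g ` B) = emeasure \<mu> B)"

definition locally_totally_bounded :: "'x topology \<Rightarrow> ('x \<Rightarrow> 'y::polish_space) \<Rightarrow> bool" where
  "locally_totally_bounded X f \<longleftrightarrow> (\<forall>K. compactin X K \<longrightarrow> compact (closure (f ` K)))"

text \<open>
  A point \<open>(g\<^sub>1, \<dots>, g\<^sub>p)\<close> of the \<open>p\<close>-th power of the group is the extensional function on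
  \<open>{..<p}\<close> sending \<open>j\<close> to \<open>g\<^bsub>j+1\<^esub>\<close>; for \<open>p = 0\<close> the power is a one-point space.
\<close>

definition power_topology :: "nat \<Rightarrow> (nat \<Rightarrow> 'g::topological_space) topology" where
  "power_topology p = product_topology (\<lambda>_. euclidean) {..<p}"

text \<open>By second countability the product \<open>\<sigma>\<close>-algebra is the Borel \<open>\<sigma>\<close>-algebra of
  \<^const>\<open>power_topology\<close>. Values of the maps off the space of the product are irrelevant.\<close>

definition borel_cochains ::
  "nat \<Rightarrow> ((nat \<Rightarrow> 'g::{topological_group_add, t2_space, second_countable_topology})
            \<Rightarrow> 'a::{polish_space, topological_ab_group_add}) set"
where
  "borel_cochains p = borel_measurable (PiM {..<p} (\<lambda>_. borel))"

definition ae_rel ::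
  "'g::{topological_group_add, t2_space, second_countable_topology} measure \<Rightarrow> nat \<Rightarrow>
    (((nat \<Rightarrow> 'g) \<Rightarrow> 'a::{polish_space, topological_ab_group_add}) \<times> ((nat \<Rightarrow> 'g) \<Rightarrow> 'a)) set"
where
  "ae_rel \<mu> p = {(f, f'). f \<in> borel_cochains p \<and> f' \<in> borel_cochains p \<and>
                           (AE x in PiM {..<p} (\<lambda>_. \<mu>). f x = f' x)}"

abbreviation ae_class ::
  "'g::{topological_group_add, t2_space, second_countable_topology} measure \<Rightarrow> nat \<Rightarrow>
    ((nat \<Rightarrow> 'g) \<Rightarrow> 'a::{polish_space, topological_ab_group_add}) \<Rightarrow> ((nat \<Rightarrow> 'g) \<Rightarrow> 'a) set"
where
  "ae_class \<mu> p f \<equiv> ae_rel \<mu> p `` {f}"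

text \<open>
  The group of cochains, in the multiplicative notation of HOL-Algebra. The degree is an integer.
  In degree 0 the cochains are the maps from the one-point space, that is the elements of the
  module; in negative degree the group is trivial, its only element being the class of the zero
  map on the one-point space.
\<close>

definition cochain_group ::
  "'g::{topological_group_add, t2_space, second_countable_topology} measure \<Rightarrow> int \<Rightarrow>
    ((nat \<Rightarrow> 'g) \<Rightarrow> 'a::{polish_space, topological_ab_group_add}) set monoid"
where
  "cochain_group \<mu> p =
     \<lparr>carrier = (if p < 0 then {ae_class \<mu> 0 (\<lambda>_. 0)} else borel_cochains (nat p) // ae_rel \<mu> (nat p)),
      mult = (\<lambda>X Y. \<Union>f\<in>X. \<Union>f'\<in>Y. ae_class \<mu> (nat p) (\<lambda>x. f x + f' x)),
      one = ae_class \<mu> (nat p) (\<lambda>_. 0)\<rparr>"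

definition coboundary_map ::
  "('g::topological_group_add \<Rightarrow> 'a::topological_ab_group_add \<Rightarrow> 'a) \<Rightarrow> nat \<Rightarrow>
    ((nat \<Rightarrow> 'g) \<Rightarrow> 'a) \<Rightarrow> ((nat \<Rightarrow> 'g) \<Rightarrow> 'a)"
where
  "coboundary_map T p \<phi> g =
     T (g 0) (\<phi> (\<lambda>j\<in>{..<p}. g (Suc j)))
     + (\<Sum>i = 1..p. (if even i then id else uminus)
          (\<phi> (\<lambda>j\<in>{..<p}. if Suc j < i then g j
                         else if Suc j = i then g j + g (Suc j)
                         else g (Suc j))))
     + (if even (p + 1) then id else uminus) (\<phi> (\<lambda>j\<in>{..<p}. g j))"

definition coboundary ::
  "'g::{topological_group_add, t2_space, second_countable_topology} measure \<Rightarrow>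
    ('g \<Rightarrow> 'a::{polish_space, topological_ab_group_add} \<Rightarrow> 'a) \<Rightarrow> int \<Rightarrow>
    ((nat \<Rightarrow> 'g) \<Rightarrow> 'a) set \<Rightarrow> ((nat \<Rightarrow> 'g) \<Rightarrow> 'a) set"
where
  "coboundary \<mu> T p X =
     (if p < 0 then one (cochain_group \<mu> (p + 1))
      else \<Union>\<phi>\<in>X. ae_class \<mu> (nat p + 1) (coboundary_map T (nat p) \<phi>))"

definition cocycles ::
  "'g::{topological_group_add, t2_space, second_countable_topology} measure \<Rightarrow>
    ('g \<Rightarrow> 'a::{polish_space, topological_ab_group_add} \<Rightarrow> 'a) \<Rightarrow> int \<Rightarrow>
    ((nat \<Rightarrow> 'g) \<Rightarrow> 'a) set set"
where
  "cocycles \<mu> T p = kernel (cochain_group \<mu> p) (cochain_group \<mu> (p + 1)) (coboundary \<mu> T p)"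

definition coboundaries ::
  "'g::{topological_group_add, t2_space, second_countable_topology} measure \<Rightarrow>
    ('g \<Rightarrow> 'a::{polish_space, topological_ab_group_add} \<Rightarrow> 'a) \<Rightarrow> int \<Rightarrow>
    ((nat \<Rightarrow> 'g) \<Rightarrow> 'a) set set"
where
  "coboundaries \<mu> T p = coboundary \<mu> T (p - 1) ` carrier (cochain_group \<mu> (p - 1))"

definition cohomology ::
  "'g::{topological_group_add, t2_space, second_countable_topology} measure \<Rightarrow>
    ('g \<Rightarrow> 'a::{polish_space, topological_ab_group_add} \<Rightarrow> 'a) \<Rightarrow> int \<Rightarrow>
    ((nat \<Rightarrow> 'g) \<Rightarrow> 'a) set set monoid"
where
  "cohomology \<mu> T p =
     (cochain_group \<mu> p)\<lparr>carrier := cocycles \<mu> T p\<rparr> Mod coboundaries \<mu> T p"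

end

theory Submission
  imports Defs "HOL-Probability.Infinite_Product_Measure"
begin

text \<open>
  The idea is to build the cocycle out of values on simplices that have been chosen so as not to be
  exceptional. Describe a tuple by its partial sums, so that it becomes a simplex with vertices
  \<open>0, x\<^sub>0, \<dots>, x\<^bsub>p-1\<^esub>\<close>. The coboundary is then the alternating
  sum over the faces, and the faces delete vertices. A cocycle \<open>b\<close> is called
  \<open>k\<close>-tight if, for almost every choice of \<open>x\<^sub>0, \<dots>,
  x\<^bsub>k-1\<^esub>\<close> in a compact set, the distribution of its values in the remaining
  vertices is tight, uniformly in the choice. Every measurable map is \<open>0\<close>-tight, by
  Ulam's theorem (\<open>tight_0\<close>). A \<open>p\<close>-tight cocycle of degree
  \<open>p\<close> maps almost all of any compact set into a compact set
  (\<open>tight_bounded\<close>), and then a change on a null set makes it locally totally bounded.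

  It remains to pass from \<open>k\<close> to \<open>k + 1\<close> within a cohomology class
  (\<open>tight_step\<close>). Insert into the simplex a new vertex \<open>w\<close> that is a
  function of \<open>x\<^sub>0, \<dots>, x\<^sub>k\<close>, and let \<open>\<phi>\<close> be the
  value of \<open>b\<close> after the insertion, as a cochain of degree one less. The cocycle
  identity for the larger simplex expresses \<open>b\<close>, up to sign and up to the coboundary of
  \<open>\<phi>\<close>, by faces of two kinds (\<open>face_cobd_insert_vertex_cone\<close>): values
  of \<open>b\<close> on faces that contain \<open>w\<close> but have lost the base vertex or one of
  \<open>x\<^sub>0, \<dots>, x\<^sub>k\<close>, and values of \<open>\<phi>\<close> on faces that
  have lost one of these vertices. (In the last step, \<open>k = p - 1\<close>, the vertex
  \<open>w\<close> depends on all the others, and only faces of the first kind occur.) When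
  \<open>x\<^sub>0, \<dots>, x\<^sub>k\<close> are prescribed, a face of the first kind still has
  only \<open>k\<close> prescribed vertices besides its base vertex, so its values are tight in the
  other vertices and \<open>w\<close> jointly. Hence most values of \<open>w\<close> keep them tight
  in the other vertices alone. The same choice of \<open>w\<close> can keep \<open>\<phi>\<close>
  \<open>k\<close>-tight, and avoid the null set where the cocycle identity fails. The base vertex
  is handled by equivariance: the group acts continuously, so compact sets of translations preserve
  tightness.

  Tightness is measured by integrals of functions with relatively compact sublevel sets. All
  requirements on \<open>w\<close> are therefore instances of Markov's inequality, and they hold
  simultaneously on a set of positive measure. A measurable choice of \<open>w\<close> with
  countably many values exists because the admissible sets have positive measure
  (\<open>ex_selection\<close>).
\<close>

section \<open>The coboundary in terms of vertices\<close>

text \<open>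
  The order embedding of \<open>\<nat>\<close> that omits \<open>i\<close>: precomposition with it
  deletes the vertex \<open>i\<close>.
\<close>

definition skip :: "nat \<Rightarrow> nat \<Rightarrow> nat" where
  "skip i j = (if j < i then j else Suc j)"

abbreviation alt :: "nat \<Rightarrow> 'a::ab_group_add \<Rightarrow> 'a" where
  "alt i \<equiv> (if even i then id else uminus)"

text \<open>
  A cochain in \<open>n\<close> variables is a function of the whole sequence that looks only at its
  first \<open>n\<close> entries. Deleting a vertex or putting in a new one is then an operation on
  sequences, and no index sets have to be tracked.
\<close>

definition depends_first :: "nat \<Rightarrow> ((nat \<Rightarrow> 'g) \<Rightarrow> 'b) \<Rightarrow> bool" where
  "depends_first n F \<longleftrightarrow> (\<forall>x y. (\<forall>i<n. x i = y i) \<longrightarrow> F x = F y)"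

text \<open>
  A sequence \<open>x\<close> describes the simplex with vertices \<open>0, x 0, x 1,
  \<dots>\<close>. Deleting the base vertex \<open>0\<close> leaves a simplex based at \<open>x
  0\<close>; equivariance gives the value of \<open>b\<close> there. So \<open>translated T
  b\<close> is the homogeneous cochain that belongs to \<open>b\<close>.
\<close>

definition translated ::
  "('g::group_add \<Rightarrow> 'a \<Rightarrow> 'a) \<Rightarrow> ((nat \<Rightarrow> 'g) \<Rightarrow> 'a) \<Rightarrow> (nat \<Rightarrow> 'g) \<Rightarrow> 'a" where
  "translated T b x = T (x 0) (b (\<lambda>j. - x 0 + x (Suc j)))"

text \<open>
  The coboundary in vertex coordinates. Vertex \<open>x i\<close> is number \<open>i + 1\<close> of
  its simplex, whence the sign in front of the sum.
\<close>

definition face_cobd ::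
  "('g::group_add \<Rightarrow> 'a \<Rightarrow> 'a) \<Rightarrow> nat \<Rightarrow> ((nat \<Rightarrow> 'g) \<Rightarrow> 'a) \<Rightarrow> (nat \<Rightarrow> 'g) \<Rightarrow> 'a::ab_group_add" where
  "face_cobd T q b x = translated T b x - (\<Sum>i\<le>q. alt i (b (x \<circ> skip i)))"

lemma depends_firstD: "depends_first n F \<Longrightarrow> (\<And>i. i < n \<Longrightarrow> x i = y i) \<Longrightarrow> F x = F y"
  by (auto simp: depends_first_def)

lemma depends_firstI: "(\<And>x y. (\<And>i. i < n \<Longrightarrow> x i = y i) \<Longrightarrow> F x = F y) \<Longrightarrow> depends_first n F"
  unfolding depends_first_def by blast

lemma inj_skip: "inj (skip i)"
  by (auto simp: inj_def skip_def split: if_splits)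

lemma alt_add: "alt i (a + b) = alt i a + alt i b"
  by simp
lemma alt_diff: "alt i (a - b) = alt i a - alt i b"
  by simp
lemma alt_Suc: "alt (Suc i) a = - alt i a"
  by simp
lemma alt_alt: "alt i (alt j a) = alt (i + j) a"
  by simp
lemma alt_zero: "alt i 0 = 0" by simp
lemma alt_sum: "alt i (sum f A) = (\<Sum>j\<in>A. alt i (f j))"
  by (simp add: sum_negf)

lemma skip_skip: "i \<le> j \<Longrightarrow> skip i \<circ> skip j = skip (Suc j) \<circ> skip i"
  by (auto simp: skip_def fun_eq_iff)

definition alternating_face_sum :: "nat \<Rightarrow> ((nat \<Rightarrow> 'g) \<Rightarrow> 'a) \<Rightarrow> (nat \<Rightarrow> 'g) \<Rightarrow> 'a::ab_group_add" where
  "alternating_face_sum n f y = (\<Sum>i\<le>n. alt i (f (y \<circ> skip i)))"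

text \<open>
  Each pair of deletions occurs twice, once in either order. The two orders are related by
  \<open>skip_skip\<close>, which shifts one index by one and so reverses the sign.
\<close>

lemma alternating_face_sum_alternating_face_sum: "alternating_face_sum (Suc n) (alternating_face_sum n f) y = 0"
proof -
  let ?t = "\<lambda>(i, j). alt (i + j) (f (y \<circ> (skip i \<circ> skip j)))"
  let ?A = "{(i, j). i \<le> j \<and> j \<le> n}"
  let ?B = "{(i, j). j < i \<and> i \<le> Suc n}"
  have "alternating_face_sum (Suc n) (alternating_face_sum n f) y = (\<Sum>i\<le>Suc n. \<Sum>j\<le>n. ?t (i, j))"
    unfolding alternating_face_sum_def alt_sum alt_alt by (simp add: comp_assoc)
  also have "\<dots> = sum ?t ({..Suc n} \<times> {..n})"
    by (simp only: sum.cartesian_product split_def fst_conv snd_conv)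
  also have "{..Suc n} \<times> {..n} = ?A \<union> ?B"
    by auto
  also have "sum ?t (?A \<union> ?B) = sum ?t ?A + sum ?t ?B"
  proof (rule sum.union_disjoint)
    show "finite ?A" by (rule finite_subset[of _ "{..n} \<times> {..n}"]) auto
    show "finite ?B" by (rule finite_subset[of _ "{..Suc n} \<times> {..Suc n}"]) auto
  qed auto
  also have "sum ?t ?B = (\<Sum>z\<in>?A. - ?t z)"
  \<comment> \<open>The pair \<open>(i, j)\<close> with \<open>i \<le> j\<close> corresponds to \<open>(Suc j, i)\<close>.\<close>
  proof (rule sum.reindex_bij_witness[where i = "\<lambda>(i, j). (Suc j, i)" and j = "\<lambda>(i, j). (j, i - 1)"])
    fix z assume "z \<in> ?B"
    then obtain i j where z: "z = (Suc i, j)" "j \<le> i" "i \<le> n"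
      by (cases z; case_tac a) auto
    have "?t (j, i) = alt (j + i) (f (y \<circ> (skip (Suc i) \<circ> skip j)))"
      using skip_skip[OF z(2)] by simp
    then show "- ?t (case z of (i, j) \<Rightarrow> (j, i - 1)) = ?t z"
      by (simp add: z add.commute)
  qed auto
  finally show ?thesis by (simp only: sum_negf right_minus)
qed

locale gmodule =
  fixes T :: "'g::group_add \<Rightarrow> 'a::ab_group_add \<Rightarrow> 'a"
  assumes T_zero: "T 0 a = a"
    and T_add: "T (g + h) a = T g (T h a)"
    and T_plus: "T g (a + b) = T g a + T g b"
begin

lemma T_0: "T g 0 = 0"
  using T_plus[of g 0 0] by simp

lemma T_minus: "T g (- a) = - T g a"
  using T_plus[of g a "- a"] by (simp add: T_0 eq_neg_iff_add_eq_0 add.commute)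

lemma T_alt: "T g (alt i a) = alt i (T g a)"
  by (simp add: T_minus)

lemma T_sum: "T g (sum f A) = (\<Sum>i\<in>A. T g (f i))"
  by (induction A rule: infinite_finite_induct) (auto simp: T_0 T_plus)

lemma translated_plus: "translated T (\<lambda>x. a x + b x) x = translated T a x + translated T b x"
  by (simp add: translated_def T_plus)

lemma face_cobd_plus: "face_cobd T q (\<lambda>x. a x + b x) x = face_cobd T q a x + face_cobd T q b x"
  unfolding face_cobd_def translated_plus by (simp only: alt_add sum.distrib add_diff_add) 

lemma face_cobd_alt: "face_cobd T q (\<lambda>x. alt i (a x)) x = alt i (face_cobd T q a x)"
proof -
  have "(\<Sum>j\<le>q. alt j (alt i (a (x \<circ> skip j)))) = alt i (\<Sum>j\<le>q. alt j (a (x \<circ> skip j)))"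
    unfolding alt_sum alt_alt by (simp add: add.commute)
  then show ?thesis
    unfolding face_cobd_def translated_def T_alt by (simp only: alt_diff)
qed

lemma translated_translate: "translated T b (\<lambda>j. g + y j) = T g (translated T b y)"
proof -
  have "- (g + y 0) + (g + y (Suc j)) = - y 0 + y (Suc j)" for j
    by (simp add: minus_add add.assoc[symmetric])
  then show ?thesis by (simp add: translated_def T_add)
qed

lemma translated_case_nat: "translated T b (case_nat 0 x) = b x"
  by (simp add: translated_def T_zero)

text \<open>
  Making the base vertex explicit turns the coboundary into a plain alternating sum over faces. The
  square of the latter vanishes, and \<open>translated_face_cobd\<close> carries this back to
  \<open>face_cobd\<close>.
\<close>

lemma face_cobd_eq_alternating_face_sum: "face_cobd T q b x = alternating_face_sum (Suc q) (translated T b) (case_nat 0 x)"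
proof -
  have "case_nat 0 x \<circ> skip 0 = x" 
    by (auto simp: skip_def)
  moreover have "case_nat 0 x \<circ> skip (Suc i) = case_nat 0 (x \<circ> skip i)" for i
    by (auto simp: skip_def fun_eq_iff split: nat.split)
  ultimately show ?thesis
    unfolding face_cobd_def alternating_face_sum_def sum.atMost_Suc_shift
    by (simp only: translated_case_nat alt_Suc sum_negf) simp
qed

lemma translated_face_cobd: "translated T (face_cobd T q b) y = alternating_face_sum (Suc q) (translated T b) y"
proof -
  have *: "(\<lambda>j. y 0 + case_nat 0 (\<lambda>j. - y 0 + y (Suc j)) j) = y"
    by (auto simp: fun_eq_iff add.assoc[symmetric] split: nat.split)
  have "translated T (face_cobd T q b) y = 
      (\<Sum>i\<le>Suc q. alt i (T (y 0) (translated T b (case_nat 0 (\<lambda>j. - y 0 + y (Suc j)) \<circ> skip i))))"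
    by (simp add: translated_def[of T "face_cobd T q b"] face_cobd_eq_alternating_face_sum alternating_face_sum_def T_sum T_alt del: sum.atMost_Suc)
  also have "\<dots> = (\<Sum>i\<le>Suc q. alt i (translated T b (y \<circ> skip i)))"
    unfolding translated_translate[symmetric]
    using * by (intro sum.cong refl) (simp add: fun_eq_iff comp_def)
  finally show ?thesis by (simp add: alternating_face_sum_def)
qed

lemma face_cobd_face_cobd: "face_cobd T (Suc q) (face_cobd T q b) x = 0"
proof -
  have "translated T (face_cobd T q b) = alternating_face_sum (Suc q) (translated T b)"
    by (rule ext) (rule translated_face_cobd)
  then show ?thesis
    by (simp only: face_cobd_eq_alternating_face_sum[of "Suc q" "face_cobd T q b" x] alternating_face_sum_alternating_face_sum)
qed

end

section \<open>Good values that are reached by countably many points\<close>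

lemma borel_measurable_uminus_group [measurable (raw)]:
  fixes f :: "'x \<Rightarrow> 'b::{second_countable_topology, topological_group_add}"
  assumes "f \<in> borel_measurable M"
  shows "(\<lambda>x. - f x) \<in> borel_measurable M"
proof -
  have "continuous_on UNIV (\<lambda>x::'b. - x)" by (intro continuous_intros)
  then show ?thesis
    using borel_measurable_continuous_on assms by blast
qed

text \<open>
  A function exceeds \<open>2 ^ (n + 2)\<close> times its mean with probability at most \<open>(1/2)
  ^ (n + 2)\<close>, and these probabilities sum to \<open>1/2\<close>. So countably many
  nonnegative functions can be controlled at one point. A function of mean zero must vanish at such
  a point, and this is how null sets will be avoided.
\<close>

lemma (in prob_space) emeasure_simultaneous_Markov:
  fixes f :: "nat \<Rightarrow> 'a \<Rightarrow> ennreal"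
  assumes [measurable]: "\<And>n. f n \<in> borel_measurable M"
  shows "emeasure M {v \<in> space M. \<forall>n. f n v \<le> 2 ^ (n + 2) * (\<integral>\<^sup>+u. f n u \<partial>M)} \<noteq> 0"
proof
  define B where "B n = {v \<in> space M. \<not> f n v \<le> 2 ^ (n + 2) * (\<integral>\<^sup>+u. f n u \<partial>M)}" for n
  have [measurable]: "B n \<in> sets M" for n
    unfolding B_def by measurable
  have B: "emeasure M (B n) \<le> ennreal ((1/2) ^ (n + 2))" for n
  proof -
    let ?a = "\<integral>\<^sup>+u. f n u \<partial>M"
    consider "?a = 0" | "?a = \<infinity>" | "?a \<noteq> 0" "?a \<noteq> \<infinity>" by blast
    then show ?thesis
    proof cases
      case 1
      then have "AE v in M. f n v = 0"
        by (subst (asm) nn_integral_0_iff_AE) auto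
      then have "AE v in M. v \<notin> B n"
        by eventually_elim (auto simp: B_def)
      then have "emeasure M (B n) = 0"
        by (subst (asm) AE_iff_null_sets[symmetric]) auto
      then show ?thesis by simp
    next
      case 2
      then have "B n = {}"
        by (auto simp: B_def ennreal_mult_top)
      then show ?thesis by simp
    next
      case 3
      have "emeasure M (B n) * (2 ^ (n + 2) * ?a) = (\<integral>\<^sup>+v. (2 ^ (n + 2) * ?a) * indicator (B n) v \<partial>M)"
        by (subst nn_integral_cmult_indicator) (auto simp: mult.commute)
      also have "\<dots> \<le> (\<integral>\<^sup>+v. f n v \<partial>M)"
        by (intro nn_integral_mono) (auto simp: B_def indicator_def)
      finally have "?a * (emeasure M (B n) * 2 ^ (n + 2)) \<le> ?a * 1"
        by (simp add: ac_simps)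
      then have *: "emeasure M (B n) * 2 ^ (n + 2) \<le> 1"
        using 3 by (subst (asm) ennreal_mult_le_mult_iff) auto
      have two_top: "(2::ennreal) ^ (n + 2) \<noteq> \<infinity>"
        using ennreal_power[of 2 "n + 2"] by (simp del: power_Suc)
      have "ennreal ((1/2) ^ (n + 2)) * 2 ^ (n + 2) = ennreal ((1/2) ^ (n + 2) * 2 ^ (n + 2))"
        by (subst ennreal_mult) (auto simp: ennreal_power[symmetric] simp del: power_Suc)
      also have "(1/2) ^ (n + 2) * 2 ^ (n + 2) = (1::real)"
        by (simp add: power_mult_distrib[symmetric] del: power_Suc)
      finally have "(2::ennreal) ^ (n + 2) * emeasure M (B n) \<le> 2 ^ (n + 2) * ennreal ((1/2) ^ (n + 2))"
        using * by (simp add: mult.commute)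
      then show ?thesis
        by (subst (asm) ennreal_mult_le_mult_iff) (use two_top in auto)
    qed
  qed
  have sm: "summable (\<lambda>n. (1/2::real) ^ (n + 2))"
    by (subst summable_iff_shift) (rule summable_geometric, simp)
  have "(\<Sum>n. (1/2::real) ^ (n + 2)) = 1/2"
    using suminf_split_initial_segment[OF summable_geometric[of "1/2::real"], of 2]
    by (simp add: suminf_geometric numeral_2_eq_2 del: power_Suc)
  have "emeasure M (\<Union>n. B n) \<le> (\<Sum>n. emeasure M (B n))"
    by (rule emeasure_subadditive_countably) auto
  also have "\<dots> \<le> (\<Sum>n. ennreal ((1/2) ^ (n + 2)))"
    by (intro suminf_le B) auto
  also have "\<dots> = ennreal (\<Sum>n. (1/2) ^ (n + 2))"
    by (rule suminf_ennreal2) (use sm in auto)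
  also have "\<dots> < 1"
    using \<open>(\<Sum>n. (1/2::real) ^ (n + 2)) = 1/2\<close> by (simp add: ennreal_less_one_iff)
  finally have lt: "emeasure M (\<Union>n. B n) < 1" .
  assume "emeasure M {v \<in> space M. \<forall>n. f n v \<le> 2 ^ (n + 2) * (\<integral>\<^sup>+u. f n u \<partial>M)} = 0"
  moreover have "{v \<in> space M. \<forall>n. f n v \<le> 2 ^ (n + 2) * (\<integral>\<^sup>+u. f n u \<partial>M)} = space M - (\<Union>n. B n)"
    by (auto simp: B_def)
  ultimately have "emeasure M (space M - (\<Union>n. B n)) = 0" by simp
  then have "1 - emeasure M (\<Union>n. B n) = 0"
    by (subst (asm) emeasure_compl) (auto simp: emeasure_space_1)
  then have "1 \<le> emeasure M (\<Union>n. B n)"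
    by (rule ennreal_minus_eq_0)
  with lt show False by simp
qed

text \<open>
  This reduces a measurable choice of \<open>v\<close> with \<open>E x v\<close> to a choice among
  countably many values. A countable set that misses as little of \<open>M\<close> as possible
  misses nothing, since by Tonelli some further point would hit a non-null part of the rest.
\<close>

lemma countable_hitting_set:
  assumes "prob_space M" "prob_space N"
  assumes E[measurable]: "Measurable.pred (M \<Otimes>\<^sub>M N) (\<lambda>(x, v). E x v)"
  assumes pos: "\<And>x. x \<in> space M \<Longrightarrow> emeasure N {v \<in> space N. E x v} \<noteq> 0"
  shows "\<exists>D. countable D \<and> D \<subseteq> space N \<and> (AE x in M. \<exists>v\<in>D. E x v)"
proof -
  interpret M: prob_space M by fact
  interpret N: prob_space N by fact
  interpret MN: pair_sigma_finite M N ..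
  have [measurable]: "Measurable.pred M (\<lambda>x. E x v)" if "v \<in> space N" for v
    using measurable_compose[OF measurable_Pair2'[OF that] E] by simp
  define miss where "miss D = {x \<in> space M. \<forall>v\<in>D. \<not> E x v}" for D
  have miss[measurable]: "miss D \<in> sets M" if "countable D" "D \<subseteq> space N" for D
  proof -
    have "miss D = space M - (\<Union>v\<in>D. {x \<in> space M. E x v})"
      by (auto simp: miss_def)
    moreover have "{x \<in> space M. E x v} \<in> sets M" if "v \<in> D" for v
      using that \<open>D \<subseteq> space N\<close> by (auto simp: subset_eq)
    ultimately show ?thesis
      using that by (auto intro!: sets.countable_UN'')
  qed
  define Ds where "Ds = {D. countable D \<and> D \<subseteq> space N}"
  define A where "A = (\<lambda>D. emeasure M (miss D)) ` Ds"
  have "{} \<in> Ds" by (auto simp: Ds_def)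
  then have "A \<noteq> {}" by (auto simp: A_def)
  from ennreal_Inf_countable_INF[OF this] obtain f where f: "range f \<subseteq> A" "Inf A = (INF i::nat. f i)"
    by blast
  then have "\<forall>i. \<exists>D\<in>Ds. f i = emeasure M (miss D)"
    by (auto simp: A_def image_iff subset_eq)
  then obtain D where D: "\<And>i. D i \<in> Ds" "\<And>i. f i = emeasure M (miss (D i))"
    by metis
  define D' where "D' = (\<Union>i. D i)"
  have D': "countable D'" "D' \<subseteq> space N"
    using D(1) by (auto simp: D'_def Ds_def)
  have "emeasure M (miss D') \<le> f i" for i
    unfolding D(2) using D(1)[of i] by (intro emeasure_mono miss) (auto simp: miss_def D'_def Ds_def)
  then have le: "emeasure M (miss D') \<le> Inf A"
    unfolding f by (rule INF_greatest)
  have "emeasure M (miss D') = 0"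
  proof (rule ccontr)
    assume nz: "emeasure M (miss D') \<noteq> 0"
    let ?R = "miss D'"
    have [measurable]: "?R \<in> sets M" using D' by (rule miss)
    have "(\<integral>\<^sup>+v. (\<integral>\<^sup>+x. indicator ?R x * indicator {z. E (fst z) (snd z)} (x, v) \<partial>M) \<partial>N)
        = (\<integral>\<^sup>+x. (\<integral>\<^sup>+v. indicator ?R x * indicator {z. E (fst z) (snd z)} (x, v) \<partial>N) \<partial>M)"
      by (rule MN.Fubini') (use E in \<open>simp add: split_def\<close>)
    moreover have "\<dots> \<noteq> 0"
    proof
      assume "(\<integral>\<^sup>+x. (\<integral>\<^sup>+v. indicator ?R x * indicator {z. E (fst z) (snd z)} (x, v) \<partial>N) \<partial>M) = 0"
      then have "AE x in M. (\<integral>\<^sup>+v. indicator ?R x * indicator {z. E (fst z) (snd z)} (x, v) \<partial>N) = 0"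
        by (subst (asm) nn_integral_0_iff_AE) (use E in \<open>auto simp: split_def\<close>)
      then have "AE x in M. x \<notin> ?R"
      proof (eventually_elim)
        fix x assume z: "(\<integral>\<^sup>+v. indicator ?R x * indicator {z. E (fst z) (snd z)} (x, v) \<partial>N) = (0::ennreal)"
        show "x \<notin> ?R"
        proof
          assume x: "x \<in> ?R"
          then have xs: "x \<in> space M" by (auto simp: miss_def)
          have "(\<integral>\<^sup>+v. indicator ?R x * indicator {z. E (fst z) (snd z)} (x, v) \<partial>N)
              = (\<integral>\<^sup>+v. indicator {v \<in> space N. E x v} v \<partial>N)"
            using x by (intro nn_integral_cong) (auto simp: indicator_def)
          also have "\<dots> = emeasure N {v \<in> space N. E x v}"
            using measurable_compose[OF measurable_Pair1'[OF xs] E]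
            by (intro nn_integral_indicator) simp
          finally show False using pos[OF xs] z by simp
        qed
      qed
      then show False
        using nz by (subst (asm) AE_iff_null_sets[symmetric]) auto
    qed
    ultimately have nz': "(\<integral>\<^sup>+v. (\<integral>\<^sup>+x. indicator ?R x * indicator {z. E (fst z) (snd z)} (x, v) \<partial>M) \<partial>N) \<noteq> 0"
      by simp
    have "\<not> (AE v in N. (\<integral>\<^sup>+x. indicator ?R x * indicator {z. E (fst z) (snd z)} (x, v) \<partial>M) = (0::ennreal))"
    proof
      assume "AE v in N. (\<integral>\<^sup>+x. indicator ?R x * indicator {z. E (fst z) (snd z)} (x, v) \<partial>M) = (0::ennreal)"
      then have "(\<integral>\<^sup>+v. (\<integral>\<^sup>+x. indicator ?R x * indicator {z. E (fst z) (snd z)} (x, v) \<partial>M) \<partial>N) = (\<integral>\<^sup>+v. 0 \<partial>N)"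
        by (rule nn_integral_cong_AE)
      with nz' show False by simp
    qed
    then obtain v where v: "v \<in> space N"
      "(\<integral>\<^sup>+x. indicator ?R x * indicator {z. E (fst z) (snd z)} (x, v) \<partial>M) \<noteq> (0::ennreal)"
      by (auto intro!: AE_I2)
    have [measurable]: "Measurable.pred M (\<lambda>x. E x v)" using v(1) by simp
    have "(\<integral>\<^sup>+x. indicator ?R x * indicator {z. E (fst z) (snd z)} (x, v) \<partial>M)
        = (\<integral>\<^sup>+x. indicator {x \<in> space M. x \<in> ?R \<and> E x v} x \<partial>M)"
      by (intro nn_integral_cong) (auto simp: indicator_def)
    also have "\<dots> = emeasure M {x \<in> space M. x \<in> ?R \<and> E x v}"
      by (intro nn_integral_indicator) measurable
    finally have h: "emeasure M {x \<in> space M. x \<in> ?R \<and> E x v} \<noteq> 0" using v by simp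
    have ins: "insert v D' \<in> Ds" using D' v by (auto simp: Ds_def)
    have m: "miss (insert v D') = ?R - {x \<in> space M. x \<in> ?R \<and> E x v}"
      by (auto simp: miss_def)
    have "emeasure M ?R \<le> emeasure M (miss (insert v D'))"
      using le ins by (auto simp: A_def intro: order.trans Inf_lower)
    moreover have "emeasure M ?R = emeasure M {x \<in> space M. x \<in> ?R \<and> E x v} + emeasure M (miss (insert v D'))"
    proof -
      let ?P = "{x \<in> space M. x \<in> ?R \<and> E x v}"
      have [measurable]: "?P \<in> sets M" by measurable
      have "emeasure M ?P + emeasure M (?R - ?P) = emeasure M (?P \<union> (?R - ?P))"
        by (intro plus_emeasure) auto
      moreover have "?P \<union> (?R - ?P) = ?R" by auto
      ultimately show ?thesis by (simp add: m)
    qed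
    ultimately have "emeasure M (miss (insert v D')) + emeasure M {x \<in> space M. x \<in> ?R \<and> E x v}
        \<le> emeasure M (miss (insert v D')) + 0"
      by (simp add: add.commute)
    then show False
      unfolding ennreal_add_left_cancel_le using h M.emeasure_finite[of "miss (insert v D')"] by simp
  qed
  then have "AE x in M. x \<notin> miss D'"
    using miss[OF D'] by (intro AE_not_in) (simp add: null_sets_def)
  then have "AE x in M. \<exists>v\<in>D'. E x v"
    using AE_space by eventually_elim (auto simp: miss_def)
  with D' show ?thesis by blast
qed

section \<open>Sequences of independent points of a compact set\<close>

abbreviation seqs :: "(nat \<Rightarrow> 'g::topological_space) measure" where
  "seqs \<equiv> PiM UNIV (\<lambda>_. borel)"

lemma space_seqs [simp]: "space seqs = UNIV"
  by (simp add: space_PiM)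

lemma in_space_seqs [measurable (raw)]: "x \<in> space seqs"
  by simp

lemma measurable_reindex [measurable]: "(\<lambda>x. x \<circ> f) \<in> seqs \<rightarrow>\<^sub>M seqs"
  by (rule measurable_PiM_single') (auto simp: space_PiM)

text \<open>
  Local boundedness becomes a statement about the countably many boxes with sides \<open>K
  m\<close>. Sums and differences raise \<open>m\<close> by one only, so changes between increments
  and vertices, and translations, pass from boxes to boxes.
\<close>

locale haar_exhaustion =
  fixes \<mu> :: "'g::{topological_group_add, t2_space, second_countable_topology} measure"
    and K :: "nat \<Rightarrow> 'g set"
  assumes haar: "left_haar_measure \<mu>"
    and compact_K: "compact (K m)"
    and K_Suc: "K m \<subseteq> K (Suc m)"
    and K_add: "a \<in> K m \<Longrightarrow> b \<in> K m \<Longrightarrow> a + b \<in> K (Suc m)"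
    and K_diff: "a \<in> K m \<Longrightarrow> b \<in> K m \<Longrightarrow> - a + b \<in> K (Suc m)"
    and K_pos: "emeasure \<mu> (K m) \<noteq> 0"
    and K_exhausts: "compact Q \<Longrightarrow> \<exists>m. Q \<subseteq> K m"
begin

lemma K_mono: "m \<le> n \<Longrightarrow> K m \<subseteq> K n"
  by (rule lift_Suc_mono_le[of K]) (use K_Suc in auto)

lemma sets_mu [measurable_cong, simp]: "sets \<mu> = sets borel"
  using haar by (simp add: left_haar_measure_def)

lemma space_mu [simp]: "space \<mu> = UNIV"
  using sets_eq_imp_space_eq[OF sets_mu] by simp

lemma sets_K [measurable, simp]: "K m \<in> sets borel"
  by (intro borel_closed compact_imp_closed compact_K)

lemma K_finite: "emeasure \<mu> (K m) < \<infinity>"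
  using haar compact_K by (simp add: left_haar_measure_def)

sublocale sigma_finite_measure \<mu>
proof
  have "(\<Union>(range K)) = UNIV"
  proof -
    have "x \<in> \<Union>(range K)" for x using K_exhausts[of "{x}"] by auto
    then show ?thesis by auto
  qed
  then show "\<exists>A. countable A \<and> A \<subseteq> sets \<mu> \<and> \<Union> A = space \<mu> \<and> (\<forall>a\<in>A. emeasure \<mu> a \<noteq> \<infinity>)"
    using K_finite by (intro exI[of _ "range K"]) (auto simp: less_top[symmetric] less_imp_neq)
qed

lemma distr_left_translation: "distr \<mu> \<mu> ((+) g) = \<mu>"
proof (rule measure_eqI)
  fix B assume "B \<in> sets (distr \<mu> \<mu> ((+) g))"
  then have B: "B \<in> sets borel" by simp
  have "(+) g -` B = (+) (- g) ` B"
    by (auto simp: image_iff add.assoc[symmetric] intro!: bexI[where x = "g + _"])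
  moreover have "emeasure \<mu> ((+) (- g) ` B) = emeasure \<mu> B"
    using haar B by (simp add: left_haar_measure_def)
  ultimately show "emeasure (distr \<mu> \<mu> ((+) g)) B = emeasure \<mu> B"
    using B by (subst emeasure_distr) auto
qed simp

lemma nn_integral_left_translation:
  assumes [measurable]: "h \<in> borel_measurable borel"
  shows "(\<integral>\<^sup>+x. h (g + x) \<partial>\<mu>) = (\<integral>\<^sup>+x. h x \<partial>\<mu>)"
proof -
  have "(\<integral>\<^sup>+x. h x \<partial>\<mu>) = (\<integral>\<^sup>+x. h x \<partial>distr \<mu> \<mu> ((+) g))"
    by (simp add: distr_left_translation)
  then show ?thesis by (subst (asm) nn_integral_distr) auto
qed

text \<open>
  Normalising makes infinite powers available. On these, deleting coordinates preserves the measure,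
  and every statement about the first few coordinates lives on the same space.
\<close>

definition \<nu> :: "nat \<Rightarrow> 'g measure" where
  "\<nu> m = uniform_measure \<mu> (K m)"

lemma sets_nu [measurable_cong, simp]: "sets (\<nu> m) = sets borel"
  by (simp add: \<nu>_def)

lemma space_nu [simp]: "space (\<nu> m) = UNIV"
  by (simp add: \<nu>_def)

lemma prob_space_nu: "prob_space (\<nu> m)"
  unfolding \<nu>_def using K_pos K_finite by (intro prob_space_uniform_measure) (auto simp: less_top)

lemma nn_integral_nu:
  "h \<in> borel_measurable borel \<Longrightarrow> (\<integral>\<^sup>+x. h x \<partial>\<nu> m) = (\<integral>\<^sup>+x. h x * indicator (K m) x \<partial>\<mu>) / emeasure \<mu> (K m)"
  unfolding \<nu>_def by (rule nn_integral_uniform_measure) auto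

sublocale seq: sequence_space "\<nu> m" for m
  unfolding sequence_space_def by (intro product_prob_spaceI prob_space_nu)

definition S :: "nat \<Rightarrow> (nat \<Rightarrow> 'g) measure" where
  "S m = PiM UNIV (\<lambda>_. \<nu> m)"

lemma sets_S [measurable_cong, simp]: "sets (S m) = sets seqs"
  unfolding S_def by (rule sets_PiM_cong) auto

lemma space_S [simp]: "space (S m) = UNIV"
  unfolding S_def by (simp add: space_PiM)

sublocale S: prob_space "S m" for m
  unfolding S_def by (intro prob_space_PiM prob_space_nu)

lemma measurable_comb_seq_S [measurable]:
  "(\<lambda>(x, y). comb_seq k x y) \<in> seqs \<Otimes>\<^sub>M seqs \<rightarrow>\<^sub>M (seqs :: (nat \<Rightarrow> 'g) measure)"
  by (rule measurable_comb_seq)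

lemma measurable_comb_seq_S' [measurable (raw)]:
  assumes "f \<in> M \<rightarrow>\<^sub>M seqs" "g \<in> M \<rightarrow>\<^sub>M (seqs :: (nat \<Rightarrow> 'g) measure)"
  shows "(\<lambda>x. comb_seq k (f x) (g x)) \<in> M \<rightarrow>\<^sub>M seqs"
  using measurable_compose[OF measurable_Pair[OF assms] measurable_comb_seq_S[of k]] by simp

lemma distr_comb_seq: "distr (S m \<Otimes>\<^sub>M S m) (S m) (\<lambda>(x, y). comb_seq k x y) = S m"
  unfolding S_def by (rule seq.PiM_comb_seq)

lemma distr_case_nat: "distr (\<nu> m \<Otimes>\<^sub>M S m) (S m) (\<lambda>(s, x). case_nat s x) = S m"
  unfolding S_def by (rule seq.PiM_iter)

lemma nn_integral_comb_seq:
  assumes [measurable]: "H \<in> borel_measurable seqs"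
  shows "(\<integral>\<^sup>+x. \<integral>\<^sup>+y. H (comb_seq k x y) \<partial>S m \<partial>S m) = (\<integral>\<^sup>+x. H x \<partial>S m)"
proof -
  have "(\<integral>\<^sup>+x. H x \<partial>S m) = (\<integral>\<^sup>+x. H x \<partial>distr (S m \<Otimes>\<^sub>M S m) (S m) (\<lambda>(x, y). comb_seq k x y))"
    by (simp only: distr_comb_seq)
  also have "\<dots> = (\<integral>\<^sup>+z. H (comb_seq k (fst z) (snd z)) \<partial>(S m \<Otimes>\<^sub>M S m))"
    by (subst nn_integral_distr) (auto simp: split_def)
  also have "\<dots> = (\<integral>\<^sup>+x. \<integral>\<^sup>+y. H (comb_seq k x y) \<partial>S m \<partial>S m)"
    by (subst S.nn_integral_fst[symmetric]) auto
  finally show ?thesis ..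
qed

lemma nn_integral_case_nat:
  assumes [measurable]: "H \<in> borel_measurable seqs"
  shows "(\<integral>\<^sup>+s. \<integral>\<^sup>+x. H (case_nat s x) \<partial>S m \<partial>\<nu> m) = (\<integral>\<^sup>+x. H x \<partial>S m)"
proof -
  have "(\<integral>\<^sup>+x. H x \<partial>S m) = (\<integral>\<^sup>+x. H x \<partial>distr (\<nu> m \<Otimes>\<^sub>M S m) (S m) (\<lambda>(s, x). case_nat s x))"
    by (simp only: distr_case_nat)
  also have "\<dots> = (\<integral>\<^sup>+z. H (case_nat (fst z) (snd z)) \<partial>(\<nu> m \<Otimes>\<^sub>M S m))"
    by (subst nn_integral_distr) (auto simp: split_def)
  also have "\<dots> = (\<integral>\<^sup>+s. \<integral>\<^sup>+x. H (case_nat s x) \<partial>S m \<partial>\<nu> m)"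
    by (subst S.nn_integral_fst[symmetric]) auto
  finally show ?thesis ..
qed

lemma AE_comb_seq_D:
  assumes "AE x in S m. P x"
  shows "AE x in S m. AE y in S m. P (comb_seq k x y)"
proof -
  have "AE x in distr (S m \<Otimes>\<^sub>M S m) (S m) (\<lambda>(x, y). comb_seq k x y). P x"
    using assms by (simp only: distr_comb_seq)
  then have "AE z in S m \<Otimes>\<^sub>M S m. P ((\<lambda>(x, y). comb_seq k x y) z)"
    by (rule AE_distrD[rotated]) measurable
  then have "AE x in S m. AE y in S m. P ((\<lambda>(x, y). comb_seq k x y) (x, y))"
  proof -
    interpret pair_sigma_finite "S m" "S m" ..
    show ?thesis if "AE z in S m \<Otimes>\<^sub>M S m. P ((\<lambda>(x, y). comb_seq k x y) z)"
      using that by (rule AE_pair)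
  qed
  then show ?thesis by simp
qed

lemma AE_comb_seq_I:
  assumes [measurable]: "Measurable.pred seqs P" 
    and "AE x in S m. AE y in S m. P (comb_seq k x y)"
  shows "AE x in S m. P x"
proof -
  have "(\<integral>\<^sup>+x. indicator {x. \<not> P x} x \<partial>S m) = (\<integral>\<^sup>+x. \<integral>\<^sup>+y. indicator {x. \<not> P x} (comb_seq k x y) \<partial>S m \<partial>S m)"
    by (rule nn_integral_comb_seq[symmetric]) measurable
  also have "\<dots> = (\<integral>\<^sup>+x. \<integral>\<^sup>+y. 0 \<partial>S m \<partial>S m)"
  proof (rule nn_integral_cong_AE)
    show "AE x in S m. (\<integral>\<^sup>+y. indicator {x. \<not> P x} (comb_seq k x y) \<partial>S m) = (\<integral>\<^sup>+y. 0 \<partial>S m)"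
      using assms(2)
    proof eventually_elim
      case (elim x)
      then have "AE y in S m. indicator {x. \<not> P x} (comb_seq k x y) = (0::ennreal)"
        by eventually_elim simp
      then show ?case by (rule nn_integral_cong_AE)
    qed
  qed
  finally have "(\<integral>\<^sup>+x. indicator {x. \<not> P x} x \<partial>S m) = 0" by simp
  then have "AE x in S m. indicator {x. \<not> P x} x = (0::ennreal)"
    by (subst (asm) nn_integral_0_iff_AE) auto
  then show ?thesis by eventually_elim (auto simp: indicator_def split: if_splits)
qed

lemma AE_reindex:
  assumes "AE x in S m. P x" and f: "inj f"
  shows "AE x in S m. P (x \<circ> f)"
proof -
  have "distr (S m) (S m) (\<lambda>x. x \<circ> f) = S m"
    using distr_PiM_reindex[of UNIV "\<lambda>_. \<nu> m" f UNIV] prob_space_nu f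
    by (simp add: S_def comp_def restrict_def)
  then have "AE x in distr (S m) (S m) (\<lambda>x. x \<circ> f). P x"
    using assms(1) by (simp only:)
  then show ?thesis
    by (rule AE_distrD[rotated]) measurable
qed

text \<open>
  The constant that compares \<open>\<nu> m\<close> with \<open>\<nu> n\<close> on the smaller of
  the two sets.
\<close>

definition \<rho> :: "nat \<Rightarrow> nat \<Rightarrow> ennreal" where
  "\<rho> m n = emeasure \<mu> (K n) / emeasure \<mu> (K m)"

lemma rho_finite: "\<rho> m n < \<infinity>"
  unfolding \<rho>_def using K_finite[of n] K_pos[of m] by (simp add: ennreal_divide_eq_top_iff less_top[symmetric])

lemma rho_mult: "x / emeasure \<mu> (K m) = \<rho> m n * (x / emeasure \<mu> (K n))"
proof -
  have "\<rho> m n * (x / emeasure \<mu> (K n)) = (x * (emeasure \<mu> (K n) / emeasure \<mu> (K n))) / emeasure \<mu> (K m)"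
    by (simp add: \<rho>_def ennreal_times_divide divide_ennreal_def ac_simps)
  then show ?thesis
    using K_finite[of n] K_pos[of n] by (simp add: ennreal_divide_self less_top)
qed

lemma nn_integral_nu_mono:
  assumes [measurable]: "h \<in> borel_measurable borel" and "m \<le> n"
  shows "(\<integral>\<^sup>+x. h x \<partial>\<nu> m) \<le> \<rho> m n * (\<integral>\<^sup>+x. h x \<partial>\<nu> n)"
proof -
  have "(\<integral>\<^sup>+x. h x * indicator (K m) x \<partial>\<mu>) \<le> (\<integral>\<^sup>+x. h x * indicator (K n) x \<partial>\<mu>)"
    using K_mono[OF assms(2)] by (intro nn_integral_mono) (auto simp: indicator_def)
  then show ?thesis
    by (simp add: nn_integral_nu rho_mult[of _ m n, symmetric] divide_right_mono_ennreal)
qed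

lemma nn_integral_nu_translate:
  assumes [measurable]: "h \<in> borel_measurable borel" and "a \<in> K m"
  shows "(\<integral>\<^sup>+x. h (- a + x) \<partial>\<nu> m) \<le> \<rho> m (Suc m) * (\<integral>\<^sup>+x. h x \<partial>\<nu> (Suc m))"
proof -
  have "(\<integral>\<^sup>+x. h (- a + x) * indicator (K m) x \<partial>\<mu>)
      = (\<integral>\<^sup>+x. h (- a + (a + x)) * indicator (K m) (a + x) \<partial>\<mu>)"
    by (rule nn_integral_left_translation[symmetric]) measurable
  also have "\<dots> \<le> (\<integral>\<^sup>+x. h x * indicator (K (Suc m)) x \<partial>\<mu>)"
  proof (intro nn_integral_mono)
    fix x
    have "a + x \<in> K m \<Longrightarrow> x \<in> K (Suc m)"
      using K_diff[OF assms(2), of "a + x"] by (simp add: add.assoc[symmetric])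
    then show "h (- a + (a + x)) * indicator (K m) (a + x) \<le> h x * indicator (K (Suc m)) x"
      by (auto simp: indicator_def add.assoc[symmetric])
  qed
  finally show ?thesis
    by (simp add: nn_integral_nu rho_mult[of _ m "Suc m", symmetric] divide_right_mono_ennreal)
qed

lemma measurable_translate [measurable]: "(\<lambda>x j. - a + x j) \<in> seqs \<rightarrow>\<^sub>M (seqs :: (nat \<Rightarrow> 'g) measure)"
  by (rule measurable_PiM_single') (auto simp: space_PiM)

text \<open>
  Translation by the inverse of an element of \<open>K m\<close> maps \<open>K m\<close> into
  \<open>K (Suc m)\<close>, at the price of one factor \<open>\<rho> m (Suc m)\<close> for each
  coordinate. This is where the finiteness of the number of coordinates matters.
\<close>

lemma nn_integral_S_translate:
  assumes "H \<in> borel_measurable seqs" "depends_first q H" "a \<in> K m"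
  shows "(\<integral>\<^sup>+x. H (\<lambda>j. - a + x j) \<partial>S m) \<le> \<rho> m (Suc m) ^ q * (\<integral>\<^sup>+x. H x \<partial>S (Suc m))"
  using assms(1,2)
proof (induction q arbitrary: H)
  case 0
  then have "H = (\<lambda>_. H undefined)" by (auto simp: depends_first_def)
  then have "(\<integral>\<^sup>+x. H (\<lambda>j. - a + x j) \<partial>S m) = (\<integral>\<^sup>+x. H undefined \<partial>S m)"
    "(\<integral>\<^sup>+x. H x \<partial>S (Suc m)) = (\<integral>\<^sup>+x. H undefined \<partial>S (Suc m))" by metis+
  then show ?case by (simp add: S.emeasure_space_1[simplified])
next
  case (Suc q)
  note [measurable] = Suc.prems(1)
  have dep: "depends_first q (\<lambda>x. H (case_nat s x))" for s
  proof (rule depends_firstI)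
    fix x y :: "nat \<Rightarrow> 'g" assume "\<And>i. i < q \<Longrightarrow> x i = y i"
    then show "H (case_nat s x) = H (case_nat s y)"
      by (intro depends_firstD[OF Suc.prems(2)]) (auto split: nat.split)
  qed
  let ?c = "\<rho> m (Suc m)"
  have eq: "(\<lambda>j. - a + case_nat s x j) = case_nat (- a + s) (\<lambda>j. - a + x j)" for s x
    by (auto simp: fun_eq_iff split: nat.split)
  have "(\<integral>\<^sup>+x. H (\<lambda>j. - a + x j) \<partial>S m)
      = (\<integral>\<^sup>+s. \<integral>\<^sup>+x. H (case_nat (- a + s) (\<lambda>j. - a + x j)) \<partial>S m \<partial>\<nu> m)"
    unfolding eq[symmetric] by (rule nn_integral_case_nat[symmetric]) measurable
  also have "\<dots> \<le> (\<integral>\<^sup>+s. ?c ^ q * (\<integral>\<^sup>+x. H (case_nat (- a + s) x) \<partial>S (Suc m)) \<partial>\<nu> m)"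
    by (intro nn_integral_mono Suc.IH dep) measurable
  also have "\<dots> = ?c ^ q * (\<integral>\<^sup>+s. (\<integral>\<^sup>+x. H (case_nat (- a + s) x) \<partial>S (Suc m)) \<partial>\<nu> m)"
    by (rule nn_integral_cmult) measurable
  also have "\<dots> \<le> ?c ^ q * (?c * (\<integral>\<^sup>+s. (\<integral>\<^sup>+x. H (case_nat s x) \<partial>S (Suc m)) \<partial>\<nu> (Suc m)))"
    by (intro mult_left_mono nn_integral_nu_translate[where h = "\<lambda>s. \<integral>\<^sup>+x. H (case_nat s x) \<partial>S (Suc m)"] assms) auto
  also have "(\<integral>\<^sup>+s. (\<integral>\<^sup>+x. H (case_nat s x) \<partial>S (Suc m)) \<partial>\<nu> (Suc m)) = (\<integral>\<^sup>+x. H x \<partial>S (Suc m))"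
    by (rule nn_integral_case_nat) measurable
  finally show ?case by (simp add: ac_simps)
qed

end

context haar_exhaustion
begin

lemma AE_case_nat_I:
  assumes [measurable]: "Measurable.pred seqs P" 
    and "AE s in \<nu> m. AE x in S m. P (case_nat s x)"
  shows "AE x in S m. P x"
proof -
  have "(\<integral>\<^sup>+x. indicator {x. \<not> P x} x \<partial>S m) = (\<integral>\<^sup>+s. \<integral>\<^sup>+x. indicator {x. \<not> P x} (case_nat s x) \<partial>S m \<partial>\<nu> m)"
    by (rule nn_integral_case_nat[symmetric]) measurable
  also have "\<dots> = (\<integral>\<^sup>+s. \<integral>\<^sup>+x. 0 \<partial>S m \<partial>\<nu> m)"
  proof (rule nn_integral_cong_AE)
    show "AE s in \<nu> m. (\<integral>\<^sup>+x. indicator {x. \<not> P x} (case_nat s x) \<partial>S m) = (\<integral>\<^sup>+x. 0 \<partial>S m)"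
      using assms(2)
    proof eventually_elim
      case (elim s)
      then have "AE x in S m. indicator {x. \<not> P x} (case_nat s x) = (0::ennreal)"
        by eventually_elim simp
      then show ?case by (rule nn_integral_cong_AE)
    qed
  qed
  finally have "(\<integral>\<^sup>+x. indicator {x. \<not> P x} x \<partial>S m) = 0" by simp
  then have "AE x in S m. indicator {x. \<not> P x} x = (0::ennreal)"
    by (subst (asm) nn_integral_0_iff_AE) auto
  then show ?thesis by eventually_elim (auto simp: indicator_def split: if_splits)
qed

lemma AE_S_translate:
  assumes [measurable]: "Measurable.pred seqs P" and "depends_first q P" "a \<in> K m"
    and "AE x in S (Suc m). P x"
  shows "AE x in S m. P (\<lambda>j. - a + x j)"
proof -
  let ?I = "\<lambda>x. indicator {x. \<not> P x} x :: ennreal"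
  have "(\<integral>\<^sup>+x. ?I x \<partial>S (Suc m)) = (\<integral>\<^sup>+x. 0 \<partial>S (Suc m))"
    using assms(4) by (intro nn_integral_cong_AE) (auto elim!: eventually_mono)
  moreover have "(\<integral>\<^sup>+x. ?I (\<lambda>j. - a + x j) \<partial>S m) \<le> \<rho> m (Suc m) ^ q * (\<integral>\<^sup>+x. ?I x \<partial>S (Suc m))"
    using assms(2) by (intro nn_integral_S_translate assms(3)) (auto simp: depends_first_def indicator_def)
  ultimately have "(\<integral>\<^sup>+x. ?I (\<lambda>j. - a + x j) \<partial>S m) = 0" by simp
  then have "AE x in S m. ?I (\<lambda>j. - a + x j) = 0"
    by (subst (asm) nn_integral_0_iff_AE) auto
  then show ?thesis by eventually_elim (auto simp: indicator_def split: if_splits)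
qed

text \<open>
  A point \<open>w x\<close>, to be inserted at position \<open>k\<close>, that depends on the first
  \<open>k\<close> entries only and behaves like an average point for all the \<open>H j\<close> at
  once, up to constants. Since the constants are finite, a finite average stays finite and an
  average zero stays zero. The values of \<open>w\<close> are drawn from the fixed measure
  \<open>\<nu> 0\<close>, so that one \<open>w\<close> serves all \<open>m\<close>.
\<close>

lemma ex_selection:
  fixes H :: "nat \<Rightarrow> (nat \<Rightarrow> 'g) \<Rightarrow> ennreal"
  assumes [measurable]: "\<And>j. H j \<in> borel_measurable seqs"
  shows "\<exists>w c. w \<in> borel_measurable seqs \<and> depends_first k w \<and> (\<forall>j m. c j m < (\<infinity>::ennreal)) \<and>
    (\<forall>m. AE x in S m. \<forall>j. (\<integral>\<^sup>+y. H j (comb_seq k x (case_nat (w x) y)) \<partial>S m)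
        \<le> c j m * (\<integral>\<^sup>+y. H j (comb_seq k x y) \<partial>S m))"
proof -
  define h where "h j m x v = (\<integral>\<^sup>+y. H j (comb_seq k x (case_nat v y)) \<partial>S m)" for j m x v
  define f where "f n x v = h (fst (prod_decode n)) (snd (prod_decode n)) x v" for n x v
  define E where "E x v \<longleftrightarrow> (\<forall>n. f n x v \<le> 2 ^ (n + 2) * (\<integral>\<^sup>+u. f n x u \<partial>\<nu> 0))" for x v
  have h_meas[measurable]: "(\<lambda>(x, v). h j m x v) \<in> borel_measurable (seqs \<Otimes>\<^sub>M borel)" for j m
    unfolding h_def by measurable
  have f_meas[measurable]: "(\<lambda>(x, v). f n x v) \<in> borel_measurable (seqs \<Otimes>\<^sub>M borel)" for n
    unfolding f_def by measurable
  have E_meas[measurable]: "Measurable.pred (seqs \<Otimes>\<^sub>M borel) (\<lambda>(x, v). E x v)"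
    unfolding E_def by measurable
  have dep: "E x v = E y v" if "\<And>i. i < k \<Longrightarrow> x i = y i" for x y v
  proof -
    have "comb_seq k x z = comb_seq k y z" for z
      using that by (auto simp: comb_seq_def fun_eq_iff)
    then show ?thesis by (simp add: E_def f_def h_def)
  qed
  have "\<exists>D. countable D \<and> D \<subseteq> space (\<nu> 0) \<and> (AE x in S m. \<exists>v\<in>D. E x v)" for m
  proof (rule countable_hitting_set)
    show "prob_space (S m)" "prob_space (\<nu> 0)" by (rule S.prob_space_axioms prob_space_nu)+
    show "Measurable.pred (S m \<Otimes>\<^sub>M \<nu> 0) (\<lambda>(x, v). E x v)"
      using E_meas by (simp cong: measurable_cong_sets)
    fix x
    show "emeasure (\<nu> 0) {v \<in> space (\<nu> 0). E x v} \<noteq> 0"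
      unfolding E_def
    proof (rule prob_space.emeasure_simultaneous_Markov[OF prob_space_nu])
      fix n
      show "f n x \<in> borel_measurable (\<nu> 0)"
        using measurable_compose[OF measurable_Pair1'[of x seqs borel] f_meas[of n]] by (simp add: space_PiM)
    qed
  qed
  then obtain D where D: "\<And>m. countable (D m)" "\<And>m. AE x in S m. \<exists>v\<in>D m. E x v"
    by metis
  \<comment> \<open>The point 0 only ensures that the set is nonempty.\<close>
  define D' where "D' = insert 0 (\<Union>m. D m)"
  define d where "d = from_nat_into D'"
  have d: "range d = D'"
    unfolding d_def by (rule range_from_nat_into) (use D in \<open>auto simp: D'_def\<close>)
  define w where "w x = d (LEAST n. E x (d n))" for x
  have [measurable]: "Measurable.pred seqs (\<lambda>x. E x (d n))" for n
    using measurable_compose[OF measurable_Pair2'[of "d n" borel] E_meas] by simp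
  have w_meas[measurable]: "w \<in> borel_measurable seqs"
  proof -
    have "(\<lambda>x. LEAST n. E x (d n)) \<in> seqs \<rightarrow>\<^sub>M count_space UNIV"
      by measurable
    then show ?thesis
      unfolding w_def by (rule measurable_compose) auto
  qed
  have w_dep: "depends_first k w"
  proof (rule depends_firstI)
    fix x y :: "nat \<Rightarrow> 'g" assume "\<And>i. i < k \<Longrightarrow> x i = y i"
    then have "E x v = E y v" for v by (rule dep)
    then show "w x = w y" by (simp only: w_def)
  qed
  have w_E: "AE x in S m. E x (w x)" for m
    using D(2)[of m]
  proof eventually_elim
    case (elim x)
    then obtain v where "v \<in> D m" "E x v" by blast
    then have "v \<in> range d" by (auto simp: d D'_def)
    then obtain n where "E x (d n)" using \<open>E x v\<close> by auto
    then show "E x (w x)" unfolding w_def by (rule LeastI)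
  qed
  define c where "c j m = 2 ^ (prod_encode (j, m) + 2) * \<rho> 0 m" for j m
  have "c j m < \<infinity>" for j m
  proof -
    have "(2::ennreal) ^ (prod_encode (j, m) + 2) = ennreal (2 ^ (prod_encode (j, m) + 2))"
      using ennreal_power[of 2 "prod_encode (j, m) + 2"] by (simp del: power_Suc)
    then show ?thesis
      using rho_finite[of 0 m] unfolding c_def by (simp add: ennreal_mult_less_top del: power_Suc power_add_numeral2)
  qed
  moreover have "AE x in S m. \<forall>j. (\<integral>\<^sup>+y. H j (comb_seq k x (case_nat (w x) y)) \<partial>S m)
        \<le> c j m * (\<integral>\<^sup>+y. H j (comb_seq k x y) \<partial>S m)" for m
    using w_E
  proof eventually_elim
    case (elim x)
    show ?case
    proof
      fix j
      have f_eq: "f (prod_encode (j, m)) = h j m" by (auto simp: f_def fun_eq_iff)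
      have "h j m x (w x) \<le> 2 ^ (prod_encode (j, m) + 2) * (\<integral>\<^sup>+u. h j m x u \<partial>\<nu> 0)"
        using elim[unfolded E_def, rule_format, of "prod_encode (j, m)"] by (simp only: f_eq)
      also have "\<dots> \<le> 2 ^ (prod_encode (j, m) + 2) * (\<rho> 0 m * (\<integral>\<^sup>+u. h j m x u \<partial>\<nu> m))"
        by (intro mult_left_mono nn_integral_nu_mono) (auto simp: h_def)
      also have "(\<integral>\<^sup>+u. h j m x u \<partial>\<nu> m) = (\<integral>\<^sup>+y. H j (comb_seq k x y) \<partial>S m)"
        unfolding h_def by (rule nn_integral_case_nat[where H = "\<lambda>y. H j (comb_seq k x y)"]) measurable
      finally show "(\<integral>\<^sup>+y. H j (comb_seq k x (case_nat (w x) y)) \<partial>S m)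
        \<le> c j m * (\<integral>\<^sup>+y. H j (comb_seq k x y) \<partial>S m)"
        by (simp add: h_def c_def ac_simps)
    qed
  qed
  ultimately show ?thesis
    using w_meas w_dep by (intro exI[of _ w] exI[of _ c]) auto
qed

end

section \<open>Tightness in measure\<close>

text \<open>
  The number of \<open>n\<close> with \<open>a \<notin> C n\<close>. If \<open>level C a \<le>
  N\<close>, then \<open>a\<close> lies in one of \<open>C 0, \<dots>, C N\<close>, so sublevel sets
  are relatively compact when the sets \<open>C n\<close> are compact.
\<close>

definition level :: "(nat \<Rightarrow> 'a set) \<Rightarrow> 'a \<Rightarrow> ennreal" where
  "level C a = (\<Sum>n. indicator (- C n) a)"

lemma level_measurable [measurable]:
  fixes C :: "nat \<Rightarrow> 'a::t2_space set"
  assumes "\<And>n. compact (C n)"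
  shows "level C \<in> borel_measurable borel"
proof -
  have [measurable]: "C n \<in> sets borel" for n
    using assms by (intro borel_closed compact_imp_closed)
  show ?thesis unfolding level_def by measurable
qed

text \<open>
  How levels behave under algebraic operations: the sets \<open>E n\<close> will be sums \<open>C n
  + D n\<close>, or the images of \<open>K n \<times> C n\<close> under the action.
\<close>

lemma level_mono_indicator:
  assumes "\<And>n. c \<notin> E n \<Longrightarrow> a \<notin> C n \<or> b \<notin> D n"
  shows "level E c \<le> level C a + level D b"
proof -
  have "level E c \<le> (\<Sum>n. indicator (- C n) a + indicator (- D n) b)"
    unfolding level_def using assms by (intro suminf_le) (auto simp: indicator_def)
  also have "\<dots> = level C a + level D b"
    unfolding level_def by (rule suminf_add[symmetric]) auto
  finally show ?thesis .
qed

lemma level_le_imp_mem: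
  assumes "level C a \<le> of_nat N"
  shows "\<exists>n\<le>N. a \<in> C n"
proof (rule ccontr)
  assume *: "\<not> ?thesis"
  have "of_nat (Suc N) = (\<Sum>n<Suc N. indicator (- C n) a :: ennreal)"
    using * by (simp add: indicator_def less_Suc_eq_le)
  also have "\<dots> \<le> level C a"
    unfolding level_def by (rule sum_le_suminf) auto
  finally have "of_nat (Suc N) \<le> level C a" .
  from order.trans[OF this assms] show False by (simp only: of_nat_le_iff)
qed

locale haar_module = haar_exhaustion \<mu> K + gmodule T
  for \<mu> :: "'g::{topological_group_add, t2_space, second_countable_topology} measure"
    and K :: "nat \<Rightarrow> 'g set"
    and T :: "'g \<Rightarrow> 'a::{polish_space, topological_ab_group_add} \<Rightarrow> 'a" +
  assumes continuous_T: "continuous_on UNIV (\<lambda>(g, a). T g a)"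
begin

lemma T_measurable [measurable (raw)]:
  assumes "f \<in> borel_measurable M" "h \<in> borel_measurable M"
  shows "(\<lambda>x. T (f x) (h x)) \<in> borel_measurable M"
  using borel_measurable_continuous_on[OF continuous_T borel_measurable_Pair[OF assms]] by simp

lemma translated_measurable [measurable]:
  assumes [measurable]: "b \<in> borel_measurable seqs"
  shows "translated T b \<in> borel_measurable seqs"
proof -
  have [measurable]: "(\<lambda>x j. - x 0 + x (Suc j)) \<in> seqs \<rightarrow>\<^sub>M (seqs :: (nat \<Rightarrow> 'g) measure)"
    by (rule measurable_PiM_single') (auto simp: space_PiM)
  show ?thesis unfolding translated_def[abs_def] by measurable
qed

lemma alt_measurable [measurable (raw)]:
  fixes f :: "'x \<Rightarrow> 'a"
  assumes [measurable]: "f \<in> borel_measurable M"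
  shows "(\<lambda>x. alt i (f x)) \<in> borel_measurable M"
  by simp

lemma face_cobd_measurable [measurable]:
  assumes [measurable]: "b \<in> borel_measurable seqs"
  shows "face_cobd T q b \<in> borel_measurable seqs"
proof -
  have "(\<lambda>x. translated T b x + - (\<Sum>i\<le>q. alt i (b (x \<circ> skip i)))) \<in> borel_measurable seqs"
    by measurable
  then show ?thesis unfolding face_cobd_def[abs_def] by simp
qed

text \<open>
  For almost all choices of the first \<open>k\<close> vertices in a compact set, the values of
  \<open>b\<close> as a function of the other vertices are tight, uniformly in the choice. Bounding
  the integral of a level function, instead of asking for a compact set for each
  \<open>\<epsilon>\<close>, makes this a single integral condition, to which Markov's inequality
  applies.
\<close>

definition tight :: "nat \<Rightarrow> ((nat \<Rightarrow> 'g) \<Rightarrow> 'a) \<Rightarrow> bool" where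
  "tight k b \<longleftrightarrow> (\<exists>C. (\<forall>n. compact (C n)) \<and>
     (\<forall>m. \<exists>M<\<infinity>. AE x in S m. (\<integral>\<^sup>+y. level C (b (comb_seq k x y)) \<partial>S m) \<le> M))"

lemma tight_cong_AE:
  assumes "tight k a" "\<And>m. AE x in S m. a x = b x"
  shows "tight k b"
proof -
  obtain C where C: "\<And>n. compact (C n)"
    "\<And>m. \<exists>M<\<infinity>. AE x in S m. (\<integral>\<^sup>+y. level C (a (comb_seq k x y)) \<partial>S m) \<le> M"
    using assms(1) by (auto simp: tight_def)
  have "\<exists>M<\<infinity>. AE x in S m. (\<integral>\<^sup>+y. level C (b (comb_seq k x y)) \<partial>S m) \<le> M" for m
  proof -
    obtain M where M: "M < \<infinity>" "AE x in S m. (\<integral>\<^sup>+y. level C (a (comb_seq k x y)) \<partial>S m) \<le> M"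
      using C(2) by blast
    have "AE x in S m. (\<integral>\<^sup>+y. level C (b (comb_seq k x y)) \<partial>S m) \<le> M"
      using M(2) AE_comb_seq_D[OF assms(2), where m = m and k = k]
    proof eventually_elim
      case (elim x)
      have "(\<integral>\<^sup>+y. level C (b (comb_seq k x y)) \<partial>S m) = (\<integral>\<^sup>+y. level C (a (comb_seq k x y)) \<partial>S m)"
        by (rule nn_integral_cong_AE) (use elim(2) in eventually_elim, simp)
      with elim(1) show ?case by simp
    qed
    with M(1) show ?thesis by blast
  qed
  with C(1) show ?thesis unfolding tight_def by blast
qed

lemma tight_add:
  assumes [measurable]: "a \<in> borel_measurable seqs" "b \<in> borel_measurable seqs"
    and "tight k a" "tight k b"
  shows "tight k (\<lambda>x. a x + b x)"
proof -
  obtain C where C: "\<And>n. compact (C n)"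
    "\<And>m. \<exists>M<\<infinity>. AE x in S m. (\<integral>\<^sup>+y. level C (a (comb_seq k x y)) \<partial>S m) \<le> M"
    using assms(3) by (auto simp: tight_def)
  obtain D where D: "\<And>n. compact (D n)"
    "\<And>m. \<exists>M<\<infinity>. AE x in S m. (\<integral>\<^sup>+y. level D (b (comb_seq k x y)) \<partial>S m) \<le> M"
    using assms(4) by (auto simp: tight_def)
  note [measurable] = level_measurable[OF C(1)] level_measurable[OF D(1)]
  define E where "E n = (\<lambda>(a, b). a + b) ` (C n \<times> D n)" for n
  have E: "compact (E n)" for n
    unfolding E_def split_def
    by (intro compact_continuous_image compact_Times C D continuous_intros)
  have le: "level E (a + b) \<le> level C a + level D b" for a b
    by (rule level_mono_indicator) (auto simp: E_def)
  have "\<exists>M<\<infinity>. AE x in S m. (\<integral>\<^sup>+y. level E (a (comb_seq k x y) + b (comb_seq k x y)) \<partial>S m) \<le> M" for m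
  proof -
    obtain M where M: "M < \<infinity>" "AE x in S m. (\<integral>\<^sup>+y. level C (a (comb_seq k x y)) \<partial>S m) \<le> M"
      using C(2) by blast
    obtain N where N: "N < \<infinity>" "AE x in S m. (\<integral>\<^sup>+y. level D (b (comb_seq k x y)) \<partial>S m) \<le> N"
      using D(2) by blast
    have "AE x in S m. (\<integral>\<^sup>+y. level E (a (comb_seq k x y) + b (comb_seq k x y)) \<partial>S m) \<le> M + N"
      using M(2) N(2)
    proof eventually_elim
      case (elim x)
      have "(\<integral>\<^sup>+y. level E (a (comb_seq k x y) + b (comb_seq k x y)) \<partial>S m)
          \<le> (\<integral>\<^sup>+y. level C (a (comb_seq k x y)) + level D (b (comb_seq k x y)) \<partial>S m)"
        by (intro nn_integral_mono le)
      also have "\<dots> = (\<integral>\<^sup>+y. level C (a (comb_seq k x y)) \<partial>S m) + (\<integral>\<^sup>+y. level D (b (comb_seq k x y)) \<partial>S m)"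
        by (rule nn_integral_add) measurable
      also have "\<dots> \<le> M + N" by (intro add_mono elim)
      finally show ?case .
    qed
    moreover have "M + N < \<infinity>" using M N by (simp add: ennreal_add_less_top)
    ultimately show ?thesis by blast
  qed
  with E show ?thesis unfolding tight_def by blast
qed

lemma tight_uminus:
  assumes "tight k a"
  shows "tight k (\<lambda>x. - a x)"
proof -
  obtain C where C: "\<And>n. compact (C n)"
    "\<And>m. \<exists>M<\<infinity>. AE x in S m. (\<integral>\<^sup>+y. level C (a (comb_seq k x y)) \<partial>S m) \<le> M"
    using assms by (auto simp: tight_def)
  have "compact (uminus ` C n)" for n
    by (intro compact_continuous_image C continuous_intros)
  moreover have "level (\<lambda>n. uminus ` C n) (- x) = level C x" for x
    unfolding level_def by (intro suminf_cong) (auto simp: indicator_def image_iff)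
  ultimately show ?thesis
    using C(2) unfolding tight_def by (intro exI[of _ "\<lambda>n. uminus ` C n"]) auto
qed

lemma tight_alt: "tight k a \<Longrightarrow> tight k (\<lambda>x. alt i (a x))"
  using tight_uminus[of k a] by simp

lemma level_range_0: "level (\<lambda>_. {0}) 0 = 0"
  by (simp add: level_def indicator_def)

lemma tight_zero: "tight k (\<lambda>_. 0)"
  unfolding tight_def by (intro exI[of _ "\<lambda>_. {0}"]) (auto simp: level_range_0 intro!: exI[of _ 0])

lemma tight_sum:
  assumes "finite I" "\<And>i. i \<in> I \<Longrightarrow> a i \<in> borel_measurable seqs" "\<And>i. i \<in> I \<Longrightarrow> tight k (a i)"
  shows "tight k (\<lambda>x. \<Sum>i\<in>I. a i x)"
  using assms
proof (induction I rule: finite_induct)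
  case empty
  show ?case by (simp add: tight_zero)
next
  case (insert i I)
  have [measurable]: "\<And>j. j \<in> I \<Longrightarrow> a j \<in> borel_measurable seqs" using insert.prems by auto
  have "tight k (\<lambda>x. a i x + (\<Sum>i\<in>I. a i x))"
    using insert by (intro tight_add) auto
  with insert.hyps show ?case by simp
qed

text \<open>
  The vertices that survive the deletion of one of the first \<open>k + 1\<close> include only
  \<open>k\<close> prescribed ones.
\<close>

lemma tight_skip:
  assumes "tight k b" "i \<le> k"
  shows "tight (Suc k) (\<lambda>x. b (x \<circ> skip i))"
proof -
  obtain C where C: "\<And>n. compact (C n)"
    "\<And>m. \<exists>M<\<infinity>. AE x in S m. (\<integral>\<^sup>+y. level C (b (comb_seq k x y)) \<partial>S m) \<le> M"
    using assms(1) by (auto simp: tight_def)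
  have eq: "comb_seq (Suc k) x y \<circ> skip i = comb_seq k (x \<circ> skip i) y" for x y :: "nat \<Rightarrow> 'g"
    using assms(2) by (auto simp: fun_eq_iff comb_seq_def skip_def)
  have "\<exists>M<\<infinity>. AE x in S m. (\<integral>\<^sup>+y. level C (b (comb_seq (Suc k) x y \<circ> skip i)) \<partial>S m) \<le> M" for m
  proof -
    obtain M where M: "M < \<infinity>" "AE x in S m. (\<integral>\<^sup>+y. level C (b (comb_seq k x y)) \<partial>S m) \<le> M"
      using C(2) by blast
    have "AE x in S m. (\<integral>\<^sup>+y. level C (b (comb_seq k (x \<circ> skip i) y)) \<partial>S m) \<le> M"
      by (rule AE_reindex[OF M(2) inj_skip])
    with M(1) show ?thesis by (auto simp only: eq)
  qed
  with C(1) show ?thesis unfolding tight_def by blast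
qed

lemma Ulam_tightness:
  fixes b :: "(nat \<Rightarrow> 'g) \<Rightarrow> 'a"
  assumes [measurable]: "b \<in> borel_measurable seqs"
  shows "\<exists>C. compact C \<and> emeasure (S m) {x. b x \<notin> C} \<le> ennreal ((1/2) ^ n)"
proof -
  let ?D = "distr (S m) borel b"
  interpret D: prob_space ?D by (rule S.prob_space_distr) measurable
  have sup: "(SUP C \<in> {C. C \<subseteq> UNIV \<and> compact C}. emeasure ?D C) = 1"
    using inner_regular[of ?D UNIV] D.emeasure_space_1 by simp
  have "1 - ennreal ((1/2) ^ n) < (SUP C \<in> {C. C \<subseteq> UNIV \<and> compact C}. emeasure ?D C)"
    unfolding sup by (rule ennreal_between) auto
  then obtain C where C: "compact C" "1 - ennreal ((1/2) ^ n) < emeasure ?D C"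
    by (auto simp: less_SUP_iff)
  have [measurable]: "C \<in> sets borel" using C by (intro borel_closed compact_imp_closed)
  have "emeasure (S m) {x. b x \<notin> C} = emeasure ?D (space ?D - C)"
    by (subst emeasure_distr) (auto intro!: arg_cong[where f = "emeasure _"])
  also have "\<dots> = 1 - emeasure ?D C"
    by (subst emeasure_compl) (auto simp: D.emeasure_space_1[simplified])
  also have "\<dots> \<le> ennreal ((1/2) ^ n)"
  proof -
    have "1 \<le> emeasure ?D C + ennreal ((1/2) ^ n)"
    proof (rule ccontr)
      assume "\<not> ?thesis"
      then have "emeasure ?D C + ennreal ((1/2) ^ n) < 1" by simp
      then have "emeasure ?D C \<le> 1 - ennreal ((1/2) ^ n)"
        by (intro ennreal_le_minus_iff[THEN iffD2]) (auto simp: add.commute)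
      with C(2) show False by simp
    qed
    then show ?thesis by (simp add: ennreal_minus_le_iff)
  qed
  finally show ?thesis using C(1) by blast
qed

text \<open>
  A single finite measure on a Polish space is tight. The set \<open>C n\<close> is chosen for the
  measures \<open>S 0, \<dots>, S n\<close> together; for the measure \<open>S m\<close> only the
  first \<open>m\<close> terms of the level are uncontrolled.
\<close>

lemma tight_0:
  assumes b[measurable]: "b \<in> borel_measurable seqs"
  shows "tight 0 b"
proof -
  obtain C0 where C0: "\<And>m n. compact (C0 m n)"
    "\<And>m n. emeasure (S m) {x. b x \<notin> C0 m n} \<le> ennreal ((1/2) ^ n)"
    using Ulam_tightness[OF b] by metis
  define C where "C n = (\<Union>m\<le>n. C0 m n)" for n
  have C: "compact (C n)" for n
    unfolding C_def by (intro compact_UN C0) auto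
  have [measurable]: "C n \<in> sets borel" "C0 m n \<in> sets borel" for m n
    by (intro borel_closed compact_imp_closed C C0(1))+
  have "(\<integral>\<^sup>+y. level C (b (comb_seq 0 x y)) \<partial>S m) \<le> of_nat m + 2" for m and x :: "nat \<Rightarrow> 'g"
  proof -
    have "(\<integral>\<^sup>+y. level C (b (comb_seq 0 x y)) \<partial>S m) = (\<Sum>n. \<integral>\<^sup>+y. indicator {y. b y \<notin> C n} y \<partial>S m)"
      unfolding level_def comb_seq_0 by (subst nn_integral_suminf) (auto intro!: suminf_cong nn_integral_cong simp: indicator_def)
    also have "\<dots> = (\<Sum>n. emeasure (S m) {y. b y \<notin> C n})"
    proof (intro suminf_cong nn_integral_indicator)
      fix n
      have "{y \<in> space seqs. b y \<notin> C n} \<in> sets seqs" by measurable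
      then show "{y. b y \<notin> C n} \<in> sets (S m)" by simp
    qed
    also have "\<dots> \<le> (\<Sum>n. (if n < m then 1 else 0) + ennreal ((1/2) ^ n))"
    proof (intro suminf_le)
      fix n
      show "emeasure (S m) {y. b y \<notin> C n} \<le> (if n < m then 1 else 0) + ennreal ((1/2) ^ n)"
      proof (cases "n < m")
        case True
        then show ?thesis using S.emeasure_le_1[of m] by (simp add: add_increasing2)
      next
        case False
        have "{y \<in> space seqs. b y \<notin> C0 m n} \<in> sets seqs" by measurable
        then have "{y. b y \<notin> C0 m n} \<in> sets (S m)" by simp
        with False have "emeasure (S m) {y. b y \<notin> C n} \<le> emeasure (S m) {y. b y \<notin> C0 m n}"
          by (intro emeasure_mono) (auto simp: C_def)
        with C0(2)[of m n] False show ?thesis by (auto intro: order.trans)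
      qed
    qed auto
    also have "\<dots> = (\<Sum>n. (if n < m then 1 else 0)) + (\<Sum>n. ennreal ((1/2) ^ n))"
      by (rule suminf_add[symmetric]) auto
    also have "(\<Sum>n. (if n < m then 1 else 0)) = (of_nat m :: ennreal)"
      by (subst suminf_finite[of "{..<m}"]) auto
    also have "(\<Sum>n. ennreal ((1/2) ^ n)) = 2"
    proof -
      have "(\<Sum>n. ennreal ((1/2) ^ n)) = ennreal (\<Sum>n. (1/2) ^ n)"
        by (rule suminf_ennreal2) (auto intro: summable_geometric)
      also have "(\<Sum>n. (1/2::real) ^ n) = 2"
        by (subst suminf_geometric) auto
      finally show ?thesis by simp
    qed
    finally show ?thesis .
  qed
  moreover have "of_nat m + 2 < (\<infinity>::ennreal)" for m
    by (simp add: ennreal_add_less_top of_nat_less_top)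
  ultimately show ?thesis
    unfolding tight_def using C by (intro exI[of _ C]) (auto intro!: exI[of _ "of_nat _ + 2"])
qed

text \<open>
  The counterpart of \<open>tight_skip\<close> for the base vertex. The new base point lies in
  \<open>K m\<close>, which acts on compact sets with compact image, and moving the other vertices
  into position costs a constant factor and a step from \<open>m\<close> to \<open>Suc m\<close>.
\<close>

lemma tight_translated:
  assumes b[measurable]: "b \<in> borel_measurable seqs" and dep: "depends_first q b" and "tight k b"
  shows "tight (Suc k) (translated T b)"
proof -
  obtain C where C: "\<And>n. compact (C n)"
    "\<And>m. \<exists>M<\<infinity>. AE x in S m. (\<integral>\<^sup>+y. level C (b (comb_seq k x y)) \<partial>S m) \<le> M"
    using assms(3) by (auto simp: tight_def)
  define E where "E n = (\<lambda>(g, a). T g a) ` (K n \<times> C n)" for n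
  have E: "compact (E n)" for n
    unfolding E_def
    by (intro compact_continuous_image compact_Times C compact_K continuous_on_subset[OF continuous_T]) auto
  note [measurable] = level_measurable[OF C(1)] level_measurable[OF E]
  have le: "level E (T g a) \<le> of_nat m + level C a" if "g \<in> K m" for g a m
  proof -
    have "level E (T g a) \<le> level K g + level C a"
      by (rule level_mono_indicator) (auto simp: E_def)
    also have "level K g \<le> of_nat m"
    proof -
      have "level K g = (\<Sum>n<m. indicator (- K n) g)"
        unfolding level_def
        using that K_mono by (intro suminf_finite) (auto simp: indicator_def not_less)
      also have "\<dots> \<le> (\<Sum>n<m. 1)" by (intro sum_mono) (auto simp: indicator_def)
      finally show ?thesis by simp
    qed
    finally show ?thesis by (simp add: add_right_mono)
  qed
  have "\<exists>M<\<infinity>. AE x in S m. (\<integral>\<^sup>+y. level E (translated T b (comb_seq (Suc k) x y)) \<partial>S m) \<le> M" for m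
  proof -
    let ?c = "\<rho> m (Suc m) ^ q"
    define I where "I z = (\<integral>\<^sup>+y. level C (b (comb_seq k z y)) \<partial>S (Suc m))" for z
    have [measurable]: "I \<in> borel_measurable seqs" unfolding I_def by measurable
    obtain M where M: "M < \<infinity>" "AE z in S (Suc m). I z \<le> M"
      using C(2)[of "Suc m"] unfolding I_def by blast
    have depI: "depends_first k (\<lambda>z. I z \<le> M)"
    proof (rule depends_firstI)
      fix z z' :: "nat \<Rightarrow> 'g" assume "\<And>i. i < k \<Longrightarrow> z i = z' i"
      then have "comb_seq k z y = comb_seq k z' y" for y
        by (auto simp: comb_seq_def fun_eq_iff)
      then show "(I z \<le> M) = (I z' \<le> M)" by (simp add: I_def)
    qed
    have "AE x in S m. (\<integral>\<^sup>+y. level E (translated T b (comb_seq (Suc k) x y)) \<partial>S m) \<le> of_nat m + ?c * M"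
    proof (rule AE_case_nat_I)
      have "AE a in \<nu> m. a \<in> K m"
        unfolding \<nu>_def by (rule AE_uniform_measureI) auto
      then show "AE a in \<nu> m. AE x in S m. 
        (\<integral>\<^sup>+y. level E (translated T b (comb_seq (Suc k) (case_nat a x) y)) \<partial>S m) \<le> of_nat m + ?c * M"
      proof eventually_elim
        case (elim a)
        note a = elim
        have "AE x in S m. I (\<lambda>j. - a + x j) \<le> M"
          by (rule AE_S_translate[OF _ depI elim M(2)]) measurable
        then show ?case
        proof eventually_elim
          case (elim x)
          let ?z = "\<lambda>j. - a + x j"
          have eq: "translated T b (comb_seq (Suc k) (case_nat a x) y) = T a (b (comb_seq k ?z (\<lambda>j. - a + y j)))" for y
          proof -
            have "(\<lambda>j. - a + comb_seq (Suc k) (case_nat a x) y (Suc j)) = comb_seq k ?z (\<lambda>j. - a + y j)"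
              by (auto simp: fun_eq_iff comb_seq_def)
            then show ?thesis by (simp add: translated_def comb_seq_def[of "Suc k" _ _ 0])
          qed
          have "(\<integral>\<^sup>+y. level E (translated T b (comb_seq (Suc k) (case_nat a x) y)) \<partial>S m)
            \<le> (\<integral>\<^sup>+y. of_nat m + level C (b (comb_seq k ?z (\<lambda>j. - a + y j))) \<partial>S m)"
            unfolding eq by (intro nn_integral_mono le a)
          also have "\<dots> = of_nat m + (\<integral>\<^sup>+y. level C (b (comb_seq k ?z (\<lambda>j. - a + y j))) \<partial>S m)"
            by (subst nn_integral_add) (auto simp: S.emeasure_space_1[simplified])
          also have "(\<integral>\<^sup>+y. level C (b (comb_seq k ?z (\<lambda>j. - a + y j))) \<partial>S m) \<le> ?c * I ?z"
            unfolding I_def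
          proof (rule nn_integral_S_translate)
            show "depends_first q (\<lambda>y. level C (b (comb_seq k ?z y)))"
              by (rule depends_firstI, rule arg_cong[where f = "level C"], rule depends_firstD[OF dep]) (auto simp: comb_seq_def)
          qed (measurable, rule a)
          also have "?c * I ?z \<le> ?c * M" by (intro mult_left_mono elim) auto
          finally show ?case by (simp add: add_left_mono)
        qed
      qed
    qed measurable
    moreover have "of_nat m + ?c * M < \<infinity>"
      using M(1) rho_finite[of m "Suc m"]
      by (simp add: ennreal_add_less_top ennreal_mult_less_top power_less_top_ennreal of_nat_less_top)
    ultimately show ?thesis by blast
  qed
  with E show ?thesis unfolding tight_def by blast
qed

text \<open>
  Once all variables of \<open>b\<close> are prescribed, the integral is the integral of a constant,
  and tightness says that almost all values over a box lie in a compact set.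
\<close>

lemma tight_bounded:
  assumes "tight p b" "depends_first p b"
  shows "\<exists>Q. \<forall>m. compact (Q m) \<and> (AE x in S m. b x \<in> Q m)"
proof -
  obtain C where C: "\<And>n. compact (C n)"
    "\<And>m. \<exists>M<\<infinity>. AE x in S m. (\<integral>\<^sup>+y. level C (b (comb_seq p x y)) \<partial>S m) \<le> M"
    using assms(1) by (auto simp: tight_def)
  have "\<exists>Q. compact Q \<and> (AE x in S m. b x \<in> Q)" for m
  proof -
    obtain M where M: "M < \<infinity>" "AE x in S m. (\<integral>\<^sup>+y. level C (b (comb_seq p x y)) \<partial>S m) \<le> M"
      using C(2) by blast
    obtain N where N: "M \<le> of_nat N"
      using M(1) ennreal_Ex_less_of_nat[of M] by (auto intro: less_imp_le)
    have "AE x in S m. b x \<in> (\<Union>n\<le>N. C n)"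
      using M(2)
    proof eventually_elim
      case (elim x)
      have "b (comb_seq p x y) = b x" for y
        by (rule depends_firstD[OF assms(2)]) (auto simp: comb_seq_def)
      then have "level C (b x) \<le> M"
        using elim by (simp add: S.emeasure_space_1[simplified])
      then have "\<exists>n\<le>N. b x \<in> C n"
        using N by (intro level_le_imp_mem) simp
      then show ?case by auto
    qed
    moreover have "compact (\<Union>n\<le>N. C n)" by (intro compact_UN C) auto
    ultimately show ?thesis by blast
  qed
  then show ?thesis by metis
qed

end

section \<open>Improving tightness by inserting a vertex\<close>

definition insert_vertex :: "nat \<Rightarrow> ((nat \<Rightarrow> 'g) \<Rightarrow> 'g) \<Rightarrow> (nat \<Rightarrow> 'g) \<Rightarrow> nat \<Rightarrow> 'g" where
  "insert_vertex n w x = comb_seq n x (case_nat (w x) (\<lambda>j. x (j + n)))"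

lemma insert_vertex_apply: "insert_vertex n w x j = (if j < n then x j else if j = n then w x else x (j - 1))"
proof (cases "j \<le> n")
  case True
  then show ?thesis by (auto simp: insert_vertex_def comb_seq_def)
next
  case False
  then obtain d where "j = n + Suc d" using less_imp_Suc_add[of n j] by auto
  then show ?thesis by (simp add: insert_vertex_def comb_seq_def add.commute)
qed

lemma insert_vertex_comb_seq:
  assumes "depends_first n w"
  shows "insert_vertex n w (comb_seq n x y) = comb_seq n x (case_nat (w x) y)"
proof -
  have "w (comb_seq n x y) = w x"
    by (rule depends_firstD[OF assms]) (simp add: comb_seq_def)
  then show ?thesis by (auto simp: insert_vertex_def comb_seq_def fun_eq_iff split: nat.split)
qed

lemma insert_vertex_skip: "insert_vertex n w x \<circ> skip n = x"
  by (auto simp: insert_vertex_apply skip_def fun_eq_iff)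

lemma insert_vertex_skip_Suc:
  assumes "depends_first n w" "n \<le> i"
  shows "insert_vertex n w x \<circ> skip (Suc i) = insert_vertex n w (x \<circ> skip i)"
proof -
  have w: "w (x \<circ> skip i) = w x"
    by (rule depends_firstD[OF assms(1)]) (use assms(2) in \<open>simp add: skip_def\<close>)
  show ?thesis
    using assms(2) by (auto simp: fun_eq_iff insert_vertex_apply skip_def w)
qed

lemma insert_vertex_cong:
  assumes "depends_first n w" "n \<le> q" "\<And>i. i < q \<Longrightarrow> x i = y i" "i < Suc q"
  shows "insert_vertex n w x i = insert_vertex n w y i"
proof -
  have "w x = w y" by (rule depends_firstD[OF assms(1)]) (use assms in auto)
  then show ?thesis using assms(2-4) by (auto simp: insert_vertex_apply)
qed

lemma insert_vertex_measurable [measurable (raw)]: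
  fixes w :: "(nat \<Rightarrow> 'g::topological_space) \<Rightarrow> 'g"
  assumes [measurable]: "w \<in> borel_measurable seqs" "f \<in> M \<rightarrow>\<^sub>M seqs"
  shows "(\<lambda>x. insert_vertex n w (f x)) \<in> M \<rightarrow>\<^sub>M seqs"
proof -
  have [measurable]: "(\<lambda>x j. x (j + n)) \<in> seqs \<rightarrow>\<^sub>M (seqs :: (nat \<Rightarrow> 'g) measure)"
    by (rule measurable_PiM_single') auto
  show ?thesis unfolding insert_vertex_def by measurable
qed

lemma comb_seq_comb_seq: "comb_seq k x (comb_seq 1 y z) = comb_seq (Suc k) (comb_seq k x y) z"
proof
  fix j
  consider "j < k" | "j = k" | d where "j = Suc (k + d)"
    using less_imp_Suc_add[of k j] by fastforce
  then show "comb_seq k x (comb_seq 1 y z) j = comb_seq (Suc k) (comb_seq k x y) z j"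
    by cases (auto simp: comb_seq_def)
qed

text \<open>
  The cocycle identity for the simplex with the extra vertex, solved for the face without it.
\<close>

lemma (in gmodule) face_cobd_insert_vertex:
  fixes b :: "(nat \<Rightarrow> 'g) \<Rightarrow> 'a"
  assumes w: "depends_first n w" and n: "n \<le> Suc q" and zero: "face_cobd T (Suc q) b (insert_vertex n w x) = 0"
  shows "alt n (b x) = (translated T b (insert_vertex n w x) - (\<Sum>i<n. alt i (b (insert_vertex n w x \<circ> skip i))))
     + (\<Sum>i=n..q. alt i (b (insert_vertex n w (x \<circ> skip i))))"
proof -
  let ?f = "\<lambda>i. alt i (b (insert_vertex n w x \<circ> skip i))"
  have "sum ?f {..Suc q} = sum ?f {..<n} + (?f n + sum ?f {Suc n..Suc q})"
  proof -
    have "{..Suc q} = {..<n} \<union> {n..Suc q}" using n by auto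
    then have "sum ?f {..Suc q} = sum ?f {..<n} + sum ?f {n..Suc q}"
      by (simp only: sum.union_disjoint finite_lessThan finite_atLeastAtMost ivl_disj_int)
    then show ?thesis by (simp only: sum.atLeast_Suc_atMost[OF n])
  qed
  also have "?f n = alt n (b x)" by (simp only: insert_vertex_skip)
  also have "sum ?f {Suc n..Suc q} = (\<Sum>i=n..q. ?f (Suc i))"
    by (rule sum.shift_bounds_cl_Suc_ivl)
  also have "\<dots> = - (\<Sum>i=n..q. alt i (b (insert_vertex n w (x \<circ> skip i))))"
    unfolding sum_negf[symmetric]
    by (intro sum.cong refl) (simp only: alt_Suc insert_vertex_skip_Suc[OF w] atLeastAtMost_iff)
  finally have sum: "sum ?f {..Suc q} =
      sum ?f {..<n} + (alt n (b x) + - (\<Sum>i=n..q. alt i (b (insert_vertex n w (x \<circ> skip i)))))" .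
  have key: "s - (P + (a + - R)) = 0 \<Longrightarrow> a = s - P + R" for s P a R :: 'a
    by (simp add: algebra_simps)
  show ?thesis
    by (rule key) (use zero in \<open>simp only: face_cobd_def sum\<close>)
qed

text \<open>
  The faces that omit a vertex after the new one are values of \<open>\<phi>\<close>, as
  \<open>w\<close> does not see the omitted vertex, and they cancel against the coboundary of
  \<open>\<phi>\<close>. What remains are faces that omit the base vertex or one of the first
  \<open>n\<close>.
\<close>

lemma (in gmodule) face_cobd_insert_vertex_cone:
  fixes b :: "(nat \<Rightarrow> 'g) \<Rightarrow> 'a"
  assumes w: "depends_first n w" and n: "n \<le> q" and zero: "face_cobd T (Suc q) b (insert_vertex n w x) = 0"
  defines "\<phi> \<equiv> \<lambda>x. b (insert_vertex n w x)"
  shows "alt n (b x) + face_cobd T q \<phi> x = (translated T b (insert_vertex n w x) - (\<Sum>i<n. alt i (b (insert_vertex n w x \<circ> skip i))))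
     + (translated T \<phi> x - (\<Sum>i<n. alt i (\<phi> (x \<circ> skip i))))"
proof -
  let ?f = "\<lambda>i. alt i (\<phi> (x \<circ> skip i))"
  have "{..q} = {..<n} \<union> {n..q}" using n by auto
  then have sum: "sum ?f {..q} = sum ?f {..<n} + sum ?f {n..q}"
    by (simp only: sum.union_disjoint finite_lessThan finite_atLeastAtMost ivl_disj_int)
  have b: "alt n (b x) = (translated T b (insert_vertex n w x) - (\<Sum>i<n. alt i (b (insert_vertex n w x \<circ> skip i)))) + sum ?f {n..q}"
    using face_cobd_insert_vertex[OF w _ zero] n unfolding \<phi>_def by simp
  have key: "A + R + (s - (P + R)) = A + (s - P)" for A R s P :: 'a
    by (simp add: algebra_simps)
  show ?thesis unfolding face_cobd_def sum b by (rule key)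
qed

lemma depends_first_translated:
  assumes "depends_first q b" shows "depends_first (Suc q) (translated T b)"
proof (rule depends_firstI)
  fix x y :: "nat \<Rightarrow> 'a" assume a: "\<And>i. i < Suc q \<Longrightarrow> x i = y i"
  have "b (\<lambda>j. - x 0 + x (Suc j)) = b (\<lambda>j. - y 0 + y (Suc j))"
    by (rule depends_firstD[OF assms]) (simp add: a)
  then show "translated T b x = translated T b y" by (simp add: translated_def a)
qed

lemma depends_first_face_cobd:
  assumes "depends_first q b" shows "depends_first (Suc q) (face_cobd T q b)"
proof (rule depends_firstI)
  fix x y :: "nat \<Rightarrow> 'a" assume a: "\<And>i. i < Suc q \<Longrightarrow> x i = y i"
  have "b (x \<circ> skip i) = b (y \<circ> skip i)" for i
    by (rule depends_firstD[OF assms]) (simp add: a skip_def)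
  moreover have "translated T b x = translated T b y"
    by (rule depends_firstD[OF depends_first_translated[OF assms]]) (rule a)
  ultimately show "face_cobd T q b x = face_cobd T q b y" by (simp only: face_cobd_def)
qed

context haar_module
begin

lemma tight_insert_vertex_of_bound:
  fixes b :: "(nat \<Rightarrow> 'g) \<Rightarrow> 'a"
  assumes C: "\<And>n. compact (C n)"
    and M: "M < \<infinity>" "AE x in S m. (\<integral>\<^sup>+y. level C (b (comb_seq n x y)) \<partial>S m) \<le> M"
    and c: "c < \<infinity>" "AE x in S m. (\<integral>\<^sup>+y. level C (b (comb_seq n x (case_nat (w x) y))) \<partial>S m)
      \<le> c * (\<integral>\<^sup>+y. level C (b (comb_seq n x y)) \<partial>S m)"
    and w: "depends_first n w"
  shows "\<exists>M<\<infinity>. AE x in S m. (\<integral>\<^sup>+y. level C (b (insert_vertex n w (comb_seq n x y))) \<partial>S m) \<le> M"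
proof (intro exI conjI)
  show "c * M < \<infinity>" using c M by (simp add: ennreal_mult_less_top)
  show "AE x in S m. (\<integral>\<^sup>+y. level C (b (insert_vertex n w (comb_seq n x y))) \<partial>S m) \<le> c * M"
    using M(2) c(2)
  proof eventually_elim
    case (elim x)
    have "(\<integral>\<^sup>+y. level C (b (insert_vertex n w (comb_seq n x y))) \<partial>S m) \<le> c * (\<integral>\<^sup>+y. level C (b (comb_seq n x y)) \<partial>S m)"
      using elim(2) by (simp only: insert_vertex_comb_seq[OF w])
    also have "\<dots> \<le> c * M" by (intro mult_left_mono elim) auto
    finally show ?case .
  qed
qed

text \<open>
  The extra vertex is chosen by \<open>ex_selection\<close>, for the levels of the \<open>F
  i\<close>, for the level of \<open>b\<close> and for the indicator of the exceptional set of
  \<open>P\<close>. For \<open>b\<close> the last of the \<open>Suc k\<close> vertices that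
  \<open>w\<close> depends on is integrated out afterwards, so inserting \<open>w\<close> costs
  nothing but a constant.
\<close>

lemma vertex_insertion:
  fixes F :: "nat \<Rightarrow> (nat \<Rightarrow> 'g) \<Rightarrow> 'a" and b :: "(nat \<Rightarrow> 'g) \<Rightarrow> 'a"
  assumes F[measurable]: "\<And>i. F i \<in> borel_measurable seqs" and tF: "\<And>i. tight (Suc k) (F i)"
    and b[measurable]: "b \<in> borel_measurable seqs" and tb: "tight k b"
    and P[measurable]: "Measurable.pred seqs P" and AE_P: "\<And>m. AE x in S m. P x"
  shows "\<exists>w. w \<in> borel_measurable seqs \<and> depends_first (Suc k) w \<and>
    (\<forall>i. tight (Suc k) (\<lambda>x. F i (insert_vertex (Suc k) w x))) \<and>
    tight k (\<lambda>x. b (insert_vertex (Suc k) w x)) \<and>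
    (\<forall>m. AE x in S m. P (insert_vertex (Suc k) w x))"
proof -
  let ?n = "Suc k"
  obtain C where C: "\<And>i n. compact (C i n)"
    "\<And>i m. \<exists>M<\<infinity>. AE x in S m. (\<integral>\<^sup>+y. level (C i) (F i (comb_seq ?n x y)) \<partial>S m) \<le> M"
    using tF unfolding tight_def by metis
  obtain D where D: "\<And>n. compact (D n)"
    "\<And>m. \<exists>M<\<infinity>. AE x in S m. (\<integral>\<^sup>+y. level D (b (comb_seq k x y)) \<partial>S m) \<le> M"
    using tb unfolding tight_def by metis
  note [measurable] = level_measurable[OF C(1)] level_measurable[OF D(1)]
  \<comment> \<open>Index 0 is the exceptional set, index 1 belongs to \<open>b\<close>, the others to the family \<open>F\<close>.\<close>
  define H where "H j = (case j of 0 \<Rightarrow> (\<lambda>x. indicator {x. \<not> P x} x)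
     | Suc 0 \<Rightarrow> (\<lambda>x. level D (b x)) | Suc (Suc i) \<Rightarrow> (\<lambda>x. level (C i) (F i x)))" for j
  have "H j \<in> borel_measurable seqs" for j
    unfolding H_def by (auto split: nat.split)
  from ex_selection[of H "?n", OF this] obtain w c where w: "w \<in> borel_measurable seqs" "depends_first ?n w"
    and c: "\<And>j m. c j m < (\<infinity>::ennreal)"
    and le: "\<And>m. AE x in S m. \<forall>j. (\<integral>\<^sup>+y. H j (comb_seq ?n x (case_nat (w x) y)) \<partial>S m)
        \<le> c j m * (\<integral>\<^sup>+y. H j (comb_seq ?n x y) \<partial>S m)"
    by blast
  note [measurable] = w(1)
  have "tight ?n (\<lambda>x. F i (insert_vertex ?n w x))" for i
  proof -
    have "\<exists>M<\<infinity>. AE x in S m. (\<integral>\<^sup>+y. level (C i) (F i (insert_vertex ?n w (comb_seq ?n x y))) \<partial>S m) \<le> M" for m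
    proof -
      obtain M where M: "M < \<infinity>" "AE x in S m. (\<integral>\<^sup>+y. level (C i) (F i (comb_seq ?n x y)) \<partial>S m) \<le> M"
        using C(2) by blast
      have "AE x in S m. (\<integral>\<^sup>+y. level (C i) (F i (comb_seq ?n x (case_nat (w x) y))) \<partial>S m)
        \<le> c (Suc (Suc i)) m * (\<integral>\<^sup>+y. level (C i) (F i (comb_seq ?n x y)) \<partial>S m)"
        using le[of m]
      proof eventually_elim
        case (elim x)
        then show ?case using elim[rule_format, of "Suc (Suc i)"] by (simp add: H_def)
      qed
      from tight_insert_vertex_of_bound[where C = "C i" and b = "F i", OF C(1) M c this w(2)] show ?thesis .
    qed
    with C(1) show ?thesis unfolding tight_def by blast
  qed
  moreover have "tight k (\<lambda>x. b (insert_vertex ?n w x))"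
  proof -
    have "\<exists>M<\<infinity>. AE x in S m. (\<integral>\<^sup>+y. level D (b (insert_vertex ?n w (comb_seq k x y))) \<partial>S m) \<le> M" for m
    proof -
      obtain M where M: "M < \<infinity>" "AE x in S m. (\<integral>\<^sup>+y. level D (b (comb_seq k x y)) \<partial>S m) \<le> M"
        using D(2) by blast
      let ?c = "c 1 m"
      have "AE x in S m. (\<integral>\<^sup>+y. level D (b (insert_vertex ?n w (comb_seq ?n x y))) \<partial>S m)
        \<le> ?c * (\<integral>\<^sup>+y. level D (b (comb_seq ?n x y)) \<partial>S m)"
        using le[of m]
      proof eventually_elim
        case (elim x)
        then show ?case using elim[rule_format, of 1] by (simp add: H_def insert_vertex_comb_seq[OF w(2)])
      qed
      \<comment> \<open>The entry at position \<open>k\<close> becomes the first entry of the integrated part.\<close>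
      from AE_comb_seq_D[OF this, of k]
      have "AE x in S m. AE y in S m. (\<integral>\<^sup>+z. level D (b (insert_vertex ?n w (comb_seq k x (comb_seq 1 y z)))) \<partial>S m)
        \<le> ?c * (\<integral>\<^sup>+z. level D (b (comb_seq k x (comb_seq 1 y z))) \<partial>S m)"
        by (simp only: comb_seq_comb_seq)
      then have "AE x in S m. (\<integral>\<^sup>+y. level D (b (insert_vertex ?n w (comb_seq k x y))) \<partial>S m) \<le> ?c * M"
        using M(2)
      proof eventually_elim
        case (elim x)
        have "(\<integral>\<^sup>+y. level D (b (insert_vertex ?n w (comb_seq k x y))) \<partial>S m)
            = (\<integral>\<^sup>+y. \<integral>\<^sup>+z. level D (b (insert_vertex ?n w (comb_seq k x (comb_seq 1 y z)))) \<partial>S m \<partial>S m)"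
          by (rule nn_integral_comb_seq[symmetric]) measurable
        also have "\<dots> \<le> (\<integral>\<^sup>+y. ?c * (\<integral>\<^sup>+z. level D (b (comb_seq k x (comb_seq 1 y z))) \<partial>S m) \<partial>S m)"
          by (rule nn_integral_mono_AE) (rule elim(1))
        also have "\<dots> = ?c * (\<integral>\<^sup>+y. \<integral>\<^sup>+z. level D (b (comb_seq k x (comb_seq 1 y z))) \<partial>S m \<partial>S m)"
          by (rule nn_integral_cmult) measurable
        also have "(\<integral>\<^sup>+y. \<integral>\<^sup>+z. level D (b (comb_seq k x (comb_seq 1 y z))) \<partial>S m \<partial>S m)
            = (\<integral>\<^sup>+y. level D (b (comb_seq k x y)) \<partial>S m)"
          by (rule nn_integral_comb_seq) measurable
        also have "?c * \<dots> \<le> ?c * M" by (intro mult_left_mono elim(2)) auto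
        finally show ?case .
      qed
      moreover have "?c * M < \<infinity>" using c M(1) by (simp add: ennreal_mult_less_top)
      ultimately show ?thesis by blast
    qed
    with D(1) show ?thesis unfolding tight_def by blast
  qed
  moreover have "AE x in S m. P (insert_vertex ?n w x)" for m
  proof (rule AE_comb_seq_I)
    show "AE x in S m. AE y in S m. P (insert_vertex ?n w (comb_seq ?n x y))"
      using le[of m] AE_comb_seq_D[OF AE_P, where m = m and k = "?n"]
    proof eventually_elim
      case (elim x)
      have "(\<integral>\<^sup>+y. indicator {x. \<not> P x} (comb_seq ?n x y) \<partial>S m) = (\<integral>\<^sup>+y. 0 \<partial>S m)"
        by (rule nn_integral_cong_AE) (use elim(2) in eventually_elim, simp)
      then have "(\<integral>\<^sup>+y. indicator {x. \<not> P x} (comb_seq ?n x (case_nat (w x) y)) \<partial>S m) = 0"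
        using elim(1)[rule_format, of 0] by (simp add: H_def)
      then have "AE y in S m. indicator {x. \<not> P x} (comb_seq ?n x (case_nat (w x) y)) = (0::ennreal)"
        by (subst (asm) nn_integral_0_iff_AE) auto
      then show ?case
        by eventually_elim (auto simp: insert_vertex_comb_seq[OF w(2)] indicator_def split: if_splits)
    qed
  qed measurable
  ultimately show ?thesis using w by blast
qed

lemma tight_alternating_sum:
  fixes b :: "(nat \<Rightarrow> 'g) \<Rightarrow> 'a"
  assumes [measurable]: "a \<in> borel_measurable seqs" "\<And>i. i < n \<Longrightarrow> f i \<in> borel_measurable seqs"
    and "tight l a" "\<And>i. i < n \<Longrightarrow> tight l (f i)"
  shows "tight l (\<lambda>x. a x - (\<Sum>i<n. alt i (f i x :: 'a)))"
proof -
  have "tight l (\<lambda>x. a x + - (\<Sum>i<n. alt i (f i x)))"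
    using assms by (intro tight_add tight_uminus tight_sum tight_alt) auto
  then show ?thesis by simp
qed

text \<open>
  Both kinds of faces in \<open>face_cobd_insert_vertex_cone\<close> become tight with one more
  prescribed vertex, since each has lost one of the prescribed vertices. If \<open>k = q\<close>,
  then \<open>w\<close> depends on all vertices, no term of the form \<open>\<phi>\<close> occurs,
  and \<open>b\<close> itself is tight.
\<close>

lemma tight_step:
  fixes b :: "(nat \<Rightarrow> 'g) \<Rightarrow> 'a"
  assumes b[measurable]: "b \<in> borel_measurable seqs" and dep: "depends_first (Suc q) b"
    and cocycle: "\<And>m. AE x in S m. face_cobd T (Suc q) b x = 0"
    and tb: "tight k b" and k: "k \<le> q"
  shows "\<exists>\<phi>. \<phi> \<in> borel_measurable seqs \<and> depends_first q \<phi> \<and> tight (Suc k) (\<lambda>x. b x + face_cobd T q \<phi> x)"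
proof -
  let ?n = "Suc k"
  define F where "F i = (if i \<le> k then (\<lambda>x. b (x \<circ> skip i)) else translated T b)" for i
  have F[measurable]: "F i \<in> borel_measurable seqs" for i
    unfolding F_def by auto
  have tF: "tight ?n (F i)" for i
    using tight_skip[OF tb, of i] tight_translated[OF b dep tb] by (auto simp: F_def)
  have P: "Measurable.pred seqs (\<lambda>x. face_cobd T (Suc q) b x = 0)"
    by measurable
  obtain w where w: "w \<in> borel_measurable seqs" "depends_first ?n w"
    and t: "\<And>i. tight ?n (\<lambda>x. F i (insert_vertex ?n w x))" "tight k (\<lambda>x. b (insert_vertex ?n w x))"
    and z: "\<And>m. AE x in S m. face_cobd T (Suc q) b (insert_vertex ?n w x) = 0"
    using vertex_insertion[of F k b "\<lambda>x. face_cobd T (Suc q) b x = 0", OF F tF b tb P cocycle] by blast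
  note [measurable] = w(1)
  let ?\<phi> = "\<lambda>x. b (insert_vertex ?n w x)"
  let ?A = "\<lambda>x. translated T b (insert_vertex ?n w x) - (\<Sum>i<?n. alt i (b (insert_vertex ?n w x \<circ> skip i)))"
  let ?B = "\<lambda>x. translated T ?\<phi> x - (\<Sum>i<?n. alt i (?\<phi> (x \<circ> skip i)))"
  have A: "tight ?n ?A"
  proof (rule tight_alternating_sum)
    show "tight ?n (\<lambda>x. translated T b (insert_vertex ?n w x))" using t(1)[of ?n] by (simp add: F_def)
    show "tight ?n (\<lambda>x. b (insert_vertex ?n w x \<circ> skip i))" if "i < ?n" for i
      using t(1)[of i] that by (simp add: F_def)
  qed measurable
  show ?thesis
  proof (cases "k = q")
    case True
    have "tight ?n (\<lambda>x. alt ?n (b x))"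
    proof (rule tight_cong_AE[OF A])
      fix m
      show "AE x in S m. ?A x = alt ?n (b x)"
        using z[of m]
      proof eventually_elim
        case (elim x)
        then show ?case using face_cobd_insert_vertex[OF w(2) _ elim] True by simp
      qed
    qed
    then have "tight ?n (\<lambda>x. alt ?n (alt ?n (b x)))" by (rule tight_alt)
    then have "tight ?n b" by (simp only: alt_alt) simp
    moreover have "face_cobd T q (\<lambda>_. 0) x = 0" for x by (simp add: face_cobd_def translated_def T_0 alt_zero)
    ultimately show ?thesis
      by (intro exI[of _ "\<lambda>_. 0"]) (auto simp: depends_first_def)
  next
    case False
    then have n: "?n \<le> q" using k by simp
    have dep\<phi>: "depends_first q ?\<phi>"
      by (rule depends_firstI, rule depends_firstD[OF dep], rule insert_vertex_cong[OF w(2) n])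
    have B: "tight ?n ?B"
    proof (rule tight_alternating_sum)
      show "tight ?n (translated T ?\<phi>)"
        by (rule tight_translated[OF _ dep\<phi> t(2)]) measurable
      show "tight ?n (\<lambda>x. ?\<phi> (x \<circ> skip i))" if "i < ?n" for i
        using tight_skip[OF t(2), of i] that by simp
    qed measurable
    have "tight ?n (\<lambda>x. alt ?n (b x) + face_cobd T q ?\<phi> x)"
    proof (rule tight_cong_AE)
      have [measurable]: "(\<lambda>x. a x - c x) \<in> borel_measurable seqs" 
        if [measurable]: "a \<in> borel_measurable seqs" "c \<in> borel_measurable seqs" for a c :: "(nat \<Rightarrow> 'g) \<Rightarrow> 'a"
      proof -
        have "(\<lambda>x. a x + - c x) \<in> borel_measurable seqs" by measurable
        then show ?thesis by simp
      qed
      show "tight ?n (\<lambda>x. ?A x + ?B x)"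
        by (intro tight_add A B) measurable
      fix m
      show "AE x in S m. ?A x + ?B x = alt ?n (b x) + face_cobd T q ?\<phi> x"
        using z[of m] by eventually_elim (rule face_cobd_insert_vertex_cone[OF w(2) n, symmetric])
    qed
    then have "tight ?n (\<lambda>x. alt ?n (alt ?n (b x) + face_cobd T q ?\<phi> x))" by (rule tight_alt)
    then have "tight ?n (\<lambda>x. alt ?n (alt ?n (b x)) + face_cobd T q (\<lambda>x. alt ?n (?\<phi> x)) x)"
      by (simp only: alt_add face_cobd_alt)
    then have "tight ?n (\<lambda>x. b x + face_cobd T q (\<lambda>x. alt ?n (?\<phi> x)) x)" by (simp only: alt_alt) simp
    moreover have "depends_first q (\<lambda>x. alt ?n (?\<phi> x))"
      using dep\<phi> by (auto simp: depends_first_def)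
    moreover have "(\<lambda>x. alt ?n (?\<phi> x)) \<in> borel_measurable seqs" by measurable
    ultimately show ?thesis by blast
  qed
qed

text \<open>
  Adding a coboundary keeps \<open>b\<close> a cocycle, so \<open>tight_step\<close> can be
  iterated, and the corrections add up.
\<close>

theorem cohomologous_tight:
  fixes b :: "(nat \<Rightarrow> 'g) \<Rightarrow> 'a"
  assumes b[measurable]: "b \<in> borel_measurable seqs" and dep: "depends_first (Suc q) b"
    and cocycle: "\<And>m. AE x in S m. face_cobd T (Suc q) b x = 0"
    and k: "k \<le> Suc q"
  shows "\<exists>\<phi>. \<phi> \<in> borel_measurable seqs \<and> depends_first q \<phi> \<and> tight k (\<lambda>x. b x + face_cobd T q \<phi> x)"
  using k
proof (induction k)
  case 0
  have "face_cobd T q (\<lambda>_. 0) x = 0" for x by (simp add: face_cobd_def translated_def T_0 alt_zero)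
  then show ?case
    using tight_0[OF b] by (intro exI[of _ "\<lambda>_. 0"]) (auto simp: depends_first_def)
next
  case (Suc k)
  then obtain \<phi> where \<phi>[measurable]: "\<phi> \<in> borel_measurable seqs" and dep\<phi>: "depends_first q \<phi>"
    and t: "tight k (\<lambda>x. b x + face_cobd T q \<phi> x)"
    by auto
  have "depends_first (Suc q) (\<lambda>x. b x + face_cobd T q \<phi> x)"
    using dep depends_first_face_cobd[OF dep\<phi>, of T] unfolding depends_first_def by metis
  moreover have "AE x in S m. face_cobd T (Suc q) (\<lambda>x. b x + face_cobd T q \<phi> x) x = 0" for m
    using cocycle[of m] by eventually_elim (simp only: face_cobd_plus face_cobd_face_cobd add_0_right)
  ultimately obtain \<psi> where \<psi>[measurable]: "\<psi> \<in> borel_measurable seqs" and dep\<psi>: "depends_first q \<psi>"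
    and t': "tight (Suc k) (\<lambda>x. (b x + face_cobd T q \<phi> x) + face_cobd T q \<psi> x)"
    using tight_step[of "\<lambda>x. b x + face_cobd T q \<phi> x" q k] t Suc.prems by auto
  show ?case
  proof (intro exI conjI)
    show "tight (Suc k) (\<lambda>x. b x + face_cobd T q (\<lambda>x. \<phi> x + \<psi> x) x)"
      using t' by (simp only: face_cobd_plus add.assoc)
    show "depends_first q (\<lambda>x. \<phi> x + \<psi> x)"
      using dep\<phi> dep\<psi> unfolding depends_first_def by metis
  qed measurable
qed

end

section \<open>From vertices back to increments\<close>

context haar_exhaustion
begin

sublocale prod: product_sigma_finite "\<lambda>_::nat. \<mu>"
  by unfold_locales

lemma sets_PiM_mu [measurable_cong, simp]: "sets (PiM I (\<lambda>_. \<mu>)) = sets (PiM I (\<lambda>_. borel))"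
  by (rule sets_PiM_cong) auto

lemma nn_integral_S_first:
  assumes [measurable]: "h \<in> borel_measurable borel"
  shows "(\<integral>\<^sup>+x. h (x 0) \<partial>S m) = (\<integral>\<^sup>+s. h s \<partial>\<nu> m)"
proof -
  have "(\<integral>\<^sup>+x. h (x 0) \<partial>S m) = (\<integral>\<^sup>+s. \<integral>\<^sup>+x. h (case_nat s x 0) \<partial>S m \<partial>\<nu> m)"
    by (rule nn_integral_case_nat[symmetric]) measurable
  then show ?thesis by (simp add: S.emeasure_space_1[simplified])
qed

text \<open>
  Through this identity null sets of the \<open>p\<close>-th power of Haar measure can be tested on
  the measures \<open>S m\<close>, one box at a time.
\<close>

lemma nn_integral_PiM_S:
  assumes "H \<in> borel_measurable (PiM {..<p} (\<lambda>_. borel))"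
  shows "(\<integral>\<^sup>+x. H x * (\<Prod>i<p. indicator (K m) (x i)) \<partial>PiM {..<p} (\<lambda>_. \<mu>))
    = emeasure \<mu> (K m) ^ p * (\<integral>\<^sup>+x. H (restrict x {..<p}) \<partial>S m)"
  using assms
proof (induction p arbitrary: H)
  case 0
  have "restrict x {} = (\<lambda>_. undefined)" for x :: "nat \<Rightarrow> 'g" by auto
  then show ?case by (simp add: PiM_empty nn_integral_count_space_finite S.emeasure_space_1[simplified])
next
  case (Suc p)
  have ins: "{..<Suc p} = insert p {..<p}" by auto
  have H[measurable]: "H \<in> borel_measurable (PiM (insert p {..<p}) (\<lambda>_. borel))"
    using Suc.prems by (simp only: ins)
  let ?k = "emeasure \<mu> (K m)"
  have k: "?k \<noteq> 0" "?k \<noteq> \<infinity>" using K_pos K_finite[of m] by auto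
  define G where "G x = (\<integral>\<^sup>+y. H (x(p := y)) \<partial>\<nu> m)" for x
  have [measurable]: "(\<lambda>(x, y). H (x(p := y))) \<in> borel_measurable (PiM {..<p} (\<lambda>_. borel) \<Otimes>\<^sub>M borel)"
    by measurable
  have [measurable]: "G \<in> borel_measurable (PiM {..<p} (\<lambda>_. borel))"
    unfolding G_def by measurable
  have G: "(\<integral>\<^sup>+y. H (x(p := y)) * indicator (K m) y \<partial>\<mu>) = ?k * G x" if "x \<in> space (PiM {..<p} (\<lambda>_. borel))" for x
  proof -
    have [measurable]: "(\<lambda>y. H (x(p := y))) \<in> borel_measurable borel"
      using that by measurable
    have cancel: "?k * (a / ?k) = a" for a
      by (subst ennreal_times_divide, subst mult.commute, rule mult_divide_eq_ennreal) (use k in auto)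
    show ?thesis unfolding G_def
      by (subst nn_integral_nu) (simp_all only: cancel, measurable)
  qed
  have "(\<integral>\<^sup>+x. H x * (\<Prod>i<Suc p. indicator (K m) (x i)) \<partial>PiM {..<Suc p} (\<lambda>_. \<mu>))
      = (\<integral>\<^sup>+x. \<integral>\<^sup>+y. H (x(p := y)) * (\<Prod>i<Suc p. indicator (K m) ((x(p := y)) i)) \<partial>\<mu> \<partial>PiM {..<p} (\<lambda>_. \<mu>))"
    unfolding ins by (rule prod.product_nn_integral_insert) auto
  also have "\<dots> = (\<integral>\<^sup>+x. ?k * (G x * (\<Prod>i<p. indicator (K m) (x i))) \<partial>PiM {..<p} (\<lambda>_. \<mu>))"
  proof (rule nn_integral_cong)
    fix x assume x: "x \<in> space (PiM {..<p} (\<lambda>_. \<mu>))"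
    then have x': "x \<in> space (PiM {..<p} (\<lambda>_. borel))" by (simp add: space_PiM)
    have [measurable]: "(\<lambda>y. H (x(p := y))) \<in> borel_measurable borel"
      using x' by measurable
    have "(\<integral>\<^sup>+y. H (x(p := y)) * (\<Prod>i<Suc p. indicator (K m) ((x(p := y)) i)) \<partial>\<mu>)
       = (\<integral>\<^sup>+y. (H (x(p := y)) * indicator (K m) y) * (\<Prod>i<p. indicator (K m) (x i)) \<partial>\<mu>)"
      by (intro nn_integral_cong) (simp add: ac_simps)
    also have "\<dots> = (\<integral>\<^sup>+y. (H (x(p := y)) * indicator (K m) y) \<partial>\<mu>) * (\<Prod>i<p. indicator (K m) (x i))"
      by (rule nn_integral_multc) measurable
    finally show "(\<integral>\<^sup>+y. H (x(p := y)) * (\<Prod>i<Suc p. indicator (K m) ((x(p := y)) i)) \<partial>\<mu>)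
       = ?k * (G x * (\<Prod>i<p. indicator (K m) (x i)))"
      by (simp only: G[OF x'] mult.assoc)
  qed
  also have "\<dots> = ?k * (\<integral>\<^sup>+x. G x * (\<Prod>i<p. indicator (K m) (x i)) \<partial>PiM {..<p} (\<lambda>_. \<mu>))"
    by (rule nn_integral_cmult) measurable
  also have "\<dots> = ?k ^ Suc p * (\<integral>\<^sup>+x. G (restrict x {..<p}) \<partial>S m)"
    by (subst Suc.IH) (auto simp: ac_simps)
  also have "(\<integral>\<^sup>+x. G (restrict x {..<p}) \<partial>S m) = (\<integral>\<^sup>+x. H (restrict x {..<Suc p}) \<partial>S m)"
  proof -
    have meas: "(\<lambda>x. H (restrict x {..<Suc p})) \<in> borel_measurable seqs"
      using Suc.prems by measurable
    have r: "restrict (comb_seq p x y) {..<Suc p} = (restrict x {..<p})(p := y 0)" for x y :: "nat \<Rightarrow> 'g"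
      by (auto simp: comb_seq_def fun_eq_iff)
    have "(\<integral>\<^sup>+x. H (restrict x {..<Suc p}) \<partial>S m)
        = (\<integral>\<^sup>+x. \<integral>\<^sup>+y. H ((restrict x {..<p})(p := y 0)) \<partial>S m \<partial>S m)"
      unfolding r[symmetric] using meas by (rule nn_integral_comb_seq[symmetric])
    also have "\<dots> = (\<integral>\<^sup>+x. G (restrict x {..<p}) \<partial>S m)"
      unfolding G_def
    proof (intro nn_integral_cong nn_integral_S_first)
      fix x :: "nat \<Rightarrow> 'g"
      have "restrict x {..<p} \<in> space (PiM {..<p} (\<lambda>_. borel))" by (simp add: space_PiM)
      then show "(\<lambda>y. H ((restrict x {..<p})(p := y))) \<in> borel_measurable borel" by measurable
    qed
    finally show ?thesis ..
  qed
  finally show ?case .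
qed

lemma AE_PiM_box_iff_S:
  assumes [measurable]: "Measurable.pred (PiM {..<p} (\<lambda>_. borel)) P"
  shows "(AE x in PiM {..<p} (\<lambda>_. \<mu>). (\<forall>i<p. x i \<in> K m) \<longrightarrow> P x) \<longleftrightarrow> (AE x in S m. P (restrict x {..<p}))"
proof -
  let ?H = "\<lambda>x. indicator {x. \<not> P x} x :: ennreal"
  have k: "emeasure \<mu> (K m) ^ p \<noteq> 0" using K_pos by simp
  have "(AE x in PiM {..<p} (\<lambda>_. \<mu>). (\<forall>i<p. x i \<in> K m) \<longrightarrow> P x)
    \<longleftrightarrow> (AE x in PiM {..<p} (\<lambda>_. \<mu>). ?H x * (\<Prod>i<p. indicator (K m) (x i)) = 0)"
    by (intro AE_cong) (auto simp: indicator_def)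
  also have "\<dots> \<longleftrightarrow> (\<integral>\<^sup>+x. ?H x * (\<Prod>i<p. indicator (K m) (x i)) \<partial>PiM {..<p} (\<lambda>_. \<mu>)) = 0"
    by (rule nn_integral_0_iff_AE[symmetric]) measurable
  also have "\<dots> \<longleftrightarrow> (\<integral>\<^sup>+x. ?H (restrict x {..<p}) \<partial>S m) = 0"
    by (subst nn_integral_PiM_S) (use k in auto)
  also have "\<dots> \<longleftrightarrow> (AE x in S m. ?H (restrict x {..<p}) = 0)"
    by (rule nn_integral_0_iff_AE) measurable
  also have "\<dots> \<longleftrightarrow> (AE x in S m. P (restrict x {..<p}))"
    by (intro AE_cong) (auto simp: indicator_def)
  finally show ?thesis .
qed

lemma AE_PiM_iff_S:
  assumes [measurable]: "Measurable.pred (PiM {..<p} (\<lambda>_. borel)) P"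
  shows "(AE x in PiM {..<p} (\<lambda>_. \<mu>). P x) \<longleftrightarrow> (\<forall>m. AE x in S m. P (restrict x {..<p}))"
proof -
  have "\<exists>m. \<forall>i<p. x i \<in> K m" for x :: "nat \<Rightarrow> 'g"
  proof -
    have "compact (x ` {..<p})" by (intro finite_imp_compact) simp
    then show ?thesis using K_exhausts by (meson imageI lessThan_iff subset_eq)
  qed
  then have "(AE x in PiM {..<p} (\<lambda>_. \<mu>). P x) \<longleftrightarrow> (AE x in PiM {..<p} (\<lambda>_. \<mu>). \<forall>m. (\<forall>i<p. x i \<in> K m) \<longrightarrow> P x)"
    by (intro AE_cong) meson
  then show ?thesis by (simp only: AE_all_countable AE_PiM_box_iff_S[OF assms])
qed

end

text \<open>
  The vertices of the simplex with the given increments.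
\<close>

primrec partial_sums :: "(nat \<Rightarrow> 'g::monoid_add) \<Rightarrow> nat \<Rightarrow> 'g" where
  "partial_sums g 0 = g 0"
| "partial_sums g (Suc j) = partial_sums g j + g (Suc j)"

lemma partial_sums_cong: "(\<And>i. i \<le> j \<Longrightarrow> g i = h i) \<Longrightarrow> partial_sums g j = partial_sums h j"
  by (induction j) auto

lemma partial_sums_Suc_shift:
  fixes g :: "nat \<Rightarrow> 'g::group_add"
  shows "partial_sums (\<lambda>j. g (Suc j)) j = - g 0 + partial_sums g (Suc j)"
  by (induction j) (auto simp: add.assoc[symmetric])

lemma partial_sums_merge:
  fixes g :: "nat \<Rightarrow> 'g::monoid_add"
  shows "partial_sums (\<lambda>j. if j < i then g j else if j = i then g j + g (Suc j) else g (Suc j)) j = partial_sums g (skip i j)"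
  by (induction j) (auto simp: skip_def add.assoc)

text \<open>
  Inverse to \<open>partial_sums\<close>. The result is extensional, because Borel cochains are only
  controlled on such arguments.
\<close>

definition increments :: "nat \<Rightarrow> (nat \<Rightarrow> 'g::group_add) \<Rightarrow> nat \<Rightarrow> 'g" where
  "increments p x = (\<lambda>j\<in>{..<p}. if j = 0 then x 0 else - x (j - 1) + x j)"

lemma increments_partial_sums: "increments p (partial_sums g) = restrict g {..<p}"
proof
  fix j
  show "increments p (partial_sums g) j = restrict g {..<p} j"
    by (cases j) (auto simp: increments_def add.assoc[symmetric])
qed

lemma measurable_component_any:
  "(\<lambda>x. x i) \<in> PiM I (\<lambda>_. borel) \<rightarrow>\<^sub>M (borel :: 'g::topological_space measure)"
proof (cases "i \<in> I")
  case True
  then show ?thesis by (rule measurable_component_singleton)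
next
  case False
  then have "x i = undefined" if "x \<in> space (PiM I (\<lambda>_. borel :: 'g measure))" for x
    using that by (auto simp: space_PiM PiE_def extensional_def)
  then show ?thesis
    by (subst measurable_cong[where g = "\<lambda>_. undefined"]) auto
qed

lemma measurable_partial_sums [measurable]:
  "partial_sums \<in> PiM I (\<lambda>_. borel) \<rightarrow>\<^sub>M (seqs :: (nat \<Rightarrow> 'g::{topological_group_add, second_countable_topology}) measure)"
proof (rule measurable_PiM_single')
  fix j :: nat
  note [measurable] = measurable_component_any
  show "(\<lambda>g. partial_sums g j) \<in> PiM I (\<lambda>_. borel) \<rightarrow>\<^sub>M (borel :: 'g measure)"
    by (induction j) (simp_all, measurable)
qed auto

lemma measurable_increments [measurable]:
  "increments p \<in> seqs \<rightarrow>\<^sub>M PiM {..<p} (\<lambda>_. borel :: 'g::{topological_group_add, second_countable_topology} measure)"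
  unfolding increments_def[abs_def] by (intro measurable_restrict) measurable

lemma depends_first_increments: "depends_first p (\<lambda>x. f (increments p x))"
proof (rule depends_firstI)
  fix x y :: "nat \<Rightarrow> 'a" assume "\<And>i. i < p \<Longrightarrow> x i = y i"
  then have "increments p x = increments p y" by (auto simp: increments_def fun_eq_iff)
  then show "f (increments p x) = f (increments p y)" by simp
qed

lemma measurable_PiM_of_depends:
  assumes f: "f \<in> seqs \<rightarrow>\<^sub>M N" and dep: "depends_first p f"
  shows "f \<in> PiM {..<p} (\<lambda>_. borel :: 'g::topological_space measure) \<rightarrow>\<^sub>M N"
proof -
  let ?E = "\<lambda>x i. if i < p then x i else undefined"
  have res: "(\<lambda>x. ?E x) \<in> PiM {..<p} (\<lambda>_. borel) \<rightarrow>\<^sub>M (seqs :: (nat \<Rightarrow> 'g) measure)"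
  proof (rule measurable_PiM_single')
    fix i
    show "(\<lambda>x. ?E x i) \<in> PiM {..<p} (\<lambda>_. borel) \<rightarrow>\<^sub>M (borel :: 'g measure)"
      by (cases "i < p") (simp_all add: measurable_component_any)
  qed auto
  have "f (?E x) = f x" for x
    by (rule depends_firstD[OF dep]) simp
  then show ?thesis
    using measurable_compose[OF res f] by simp
qed

lemma depends_first_restrict: "depends_first p f \<Longrightarrow> f (restrict x {..<p}) = f x"
  by (rule depends_firstD) auto

context haar_exhaustion
begin

text \<open>
  The last vertex is a left translate of the last increment, so the change of variables preserves
  Haar measure one coordinate at a time.
\<close>

lemma nn_integral_partial_sums:
  assumes "H \<in> borel_measurable (PiM {..<p} (\<lambda>_. borel))"
  shows "(\<integral>\<^sup>+g. H (restrict (partial_sums g) {..<p}) \<partial>PiM {..<p} (\<lambda>_. \<mu>)) = (\<integral>\<^sup>+x. H x \<partial>PiM {..<p} (\<lambda>_. \<mu>))"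
  using assms
proof (induction p arbitrary: H)
  case 0
  have "restrict x {} = (\<lambda>_. undefined)" for x :: "nat \<Rightarrow> 'g" by auto
  then show ?case by (simp add: PiM_empty nn_integral_count_space_finite)
next
  case (Suc p)
  have ins: "{..<Suc p} = insert p {..<p}" by auto
  have H[measurable]: "H \<in> borel_measurable (PiM (insert p {..<p}) (\<lambda>_. borel))"
    using Suc.prems by (simp only: ins)
  define G where "G x = (\<integral>\<^sup>+y. H (x(p := y)) \<partial>\<mu>)" for x
  have [measurable]: "G \<in> borel_measurable (PiM {..<p} (\<lambda>_. borel))"
    unfolding G_def by measurable
  have "(\<integral>\<^sup>+g. H (restrict (partial_sums g) {..<Suc p}) \<partial>PiM {..<Suc p} (\<lambda>_. \<mu>))
      = (\<integral>\<^sup>+g. \<integral>\<^sup>+y. H (restrict (partial_sums (g(p := y))) {..<Suc p}) \<partial>\<mu> \<partial>PiM {..<p} (\<lambda>_. \<mu>))"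
    unfolding ins
  proof (rule prod.product_nn_integral_insert)
    have "(\<lambda>g. restrict (partial_sums g) (insert p {..<p})) \<in> PiM (insert p {..<p}) (\<lambda>_. borel) \<rightarrow>\<^sub>M PiM (insert p {..<p}) (\<lambda>_. borel :: 'g measure)"
      by (intro measurable_restrict) measurable
    then show "(\<lambda>g. H (restrict (partial_sums g) (insert p {..<p}))) \<in> borel_measurable (PiM (insert p {..<p}) (\<lambda>_. \<mu>))"
      by measurable
  qed auto
  also have "\<dots> = (\<integral>\<^sup>+g. G (restrict (partial_sums g) {..<p}) \<partial>PiM {..<p} (\<lambda>_. \<mu>))"
  proof (rule nn_integral_cong)
    fix g :: "nat \<Rightarrow> 'g"
    let ?X = "restrict (partial_sums g) {..<p}"
    define c where "c = (if p = 0 then 0 else partial_sums g (p - 1))"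
    have eq: "restrict (partial_sums (g(p := y))) {..<Suc p} = ?X(p := c + y)" for y
    proof
      fix j
      have "partial_sums (g(p := y)) j = partial_sums g j" if "j < p" for j
        using that by (intro partial_sums_cong) auto
      then show "restrict (partial_sums (g(p := y))) {..<Suc p} j = (?X(p := c + y)) j"
        by (cases p) (auto simp: c_def less_Suc_eq)
    qed
    have "?X \<in> space (PiM {..<p} (\<lambda>_. borel))" by (simp add: space_PiM)
    then have "(\<lambda>y. H (?X(p := y))) \<in> borel_measurable borel" by measurable
    then show "(\<integral>\<^sup>+y. H (restrict (partial_sums (g(p := y))) {..<Suc p}) \<partial>\<mu>) = G ?X"
      unfolding eq G_def by (rule nn_integral_left_translation)
  qed
  also have "\<dots> = (\<integral>\<^sup>+x. G x \<partial>PiM {..<p} (\<lambda>_. \<mu>))"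
    by (rule Suc.IH) measurable
  also have "\<dots> = (\<integral>\<^sup>+x. H x \<partial>PiM {..<Suc p} (\<lambda>_. \<mu>))"
    unfolding ins G_def by (rule prod.product_nn_integral_insert[symmetric]) auto
  finally show ?case .
qed

lemma AE_partial_sums_iff_S:
  assumes P[measurable]: "Measurable.pred seqs P" and dep: "depends_first p P"
  shows "(AE g in PiM {..<p} (\<lambda>_. \<mu>). P (partial_sums g)) \<longleftrightarrow> (\<forall>m. AE x in S m. P x)"
proof -
  note [measurable] = measurable_PiM_of_depends[OF P dep]
  note r = depends_first_restrict[OF dep]
  let ?H = "\<lambda>x. indicator {x. \<not> P x} x :: ennreal"
  have "(AE g in PiM {..<p} (\<lambda>_. \<mu>). P (partial_sums g)) \<longleftrightarrow> (AE g in PiM {..<p} (\<lambda>_. \<mu>). ?H (restrict (partial_sums g) {..<p}) = 0)"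
    by (intro AE_cong) (simp add: r indicator_def)
  also have "\<dots> \<longleftrightarrow> (\<integral>\<^sup>+g. ?H (restrict (partial_sums g) {..<p}) \<partial>PiM {..<p} (\<lambda>_. \<mu>)) = 0"
  proof (rule nn_integral_0_iff_AE[symmetric])
    have "(\<lambda>g. restrict (partial_sums g) {..<p}) \<in> PiM {..<p} (\<lambda>_. borel) \<rightarrow>\<^sub>M PiM {..<p} (\<lambda>_. borel :: 'g measure)"
      by (intro measurable_restrict) measurable
    then show "(\<lambda>g. ?H (restrict (partial_sums g) {..<p})) \<in> borel_measurable (PiM {..<p} (\<lambda>_. \<mu>))" by measurable
  qed
  also have "\<dots> \<longleftrightarrow> (\<integral>\<^sup>+x. ?H x \<partial>PiM {..<p} (\<lambda>_. \<mu>)) = 0"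
    by (subst nn_integral_partial_sums) auto
  also have "\<dots> \<longleftrightarrow> (AE x in PiM {..<p} (\<lambda>_. \<mu>). ?H x = 0)"
    by (rule nn_integral_0_iff_AE) measurable
  also have "\<dots> \<longleftrightarrow> (AE x in PiM {..<p} (\<lambda>_. \<mu>). P x)"
    by (intro AE_cong) (simp add: indicator_def)
  also have "\<dots> \<longleftrightarrow> (\<forall>m. AE x in S m. P x)"
    by (subst AE_PiM_iff_S) (auto simp: r)
  finally show ?thesis .
qed

end

text \<open>
  Adding two neighbouring increments deletes the vertex between them.
\<close>

lemma coboundary_map_partial_sums:
  fixes b :: "(nat \<Rightarrow> 'b::topological_group_add) \<Rightarrow> 'c::topological_ab_group_add"
  assumes dep: "depends_first q b"
  shows "coboundary_map T' q (\<lambda>g. b (partial_sums g)) g = face_cobd T' q b (partial_sums g)"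
proof -
  have 1: "b (partial_sums (\<lambda>j\<in>{..<q}. g (Suc j))) = b (\<lambda>j. - partial_sums g 0 + partial_sums g (Suc j))"
  proof (rule depends_firstD[OF dep])
    fix j assume "j < q"
    then have "partial_sums (\<lambda>j\<in>{..<q}. g (Suc j)) j = partial_sums (\<lambda>j. g (Suc j)) j"
      by (intro partial_sums_cong) auto
    then show "partial_sums (\<lambda>j\<in>{..<q}. g (Suc j)) j = - partial_sums g 0 + partial_sums g (Suc j)"
      by (simp only: partial_sums_Suc_shift partial_sums.simps(1))
  qed
  have 2: "b (partial_sums (\<lambda>j\<in>{..<q}. if Suc j < Suc i then g j else if Suc j = Suc i then g j + g (Suc j) else g (Suc j)))
      = b (partial_sums g \<circ> skip i)" for i
  proof (rule depends_firstD[OF dep])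
    fix j assume "j < q"
    then have "partial_sums (\<lambda>j\<in>{..<q}. if Suc j < Suc i then g j else if Suc j = Suc i then g j + g (Suc j) else g (Suc j)) j
      = partial_sums (\<lambda>j. if j < i then g j else if j = i then g j + g (Suc j) else g (Suc j)) j"
      by (intro partial_sums_cong) auto
    then show "partial_sums (\<lambda>j\<in>{..<q}. if Suc j < Suc i then g j else if Suc j = Suc i then g j + g (Suc j) else g (Suc j)) j
      = (partial_sums g \<circ> skip i) j" by (simp only: partial_sums_merge comp_def)
  qed
  have 3: "b (partial_sums (\<lambda>j\<in>{..<q}. g j)) = b (partial_sums g \<circ> skip q)"
  proof (rule depends_firstD[OF dep])
    fix j assume j: "j < q"
    then have "partial_sums (\<lambda>j\<in>{..<q}. g j) j = partial_sums g j" by (intro partial_sums_cong) auto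
    with j show "partial_sums (\<lambda>j\<in>{..<q}. g j) j = (partial_sums g \<circ> skip q) j" by (simp add: skip_def)
  qed
  have "(\<Sum>i = 1..q. alt i (b (partial_sums (\<lambda>j\<in>{..<q}. if Suc j < i then g j else if Suc j = i then g j + g (Suc j) else g (Suc j)))))
      = (\<Sum>i<q. alt (Suc i) (b (partial_sums g \<circ> skip i)))"
    unfolding One_nat_def sum.atLeast1_atMost_eq by (simp only: 2)
  also have "\<dots> = - (\<Sum>i<q. alt i (b (partial_sums g \<circ> skip i)))"
    by (simp only: alt_Suc sum_negf)
  finally have mid: "(\<Sum>i = 1..q. alt i (b (partial_sums (\<lambda>j\<in>{..<q}. if Suc j < i then g j else if Suc j = i then g j + g (Suc j) else g (Suc j)))))
      = - (\<Sum>i<q. alt i (b (partial_sums g \<circ> skip i)))" .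
  have "{..q} = insert q {..<q}" by auto
  then have last: "(\<Sum>i\<le>q. alt i (b (partial_sums g \<circ> skip i))) = alt q (b (partial_sums g \<circ> skip q)) + (\<Sum>i<q. alt i (b (partial_sums g \<circ> skip i)))"
    by (simp only: sum.insert finite_lessThan lessThan_iff less_irrefl not_False_eq_True)
  have key: "t + - s + - a = t - (a + s)" for t s a :: 'c by (simp add: algebra_simps)
  show ?thesis
    unfolding coboundary_map_def face_cobd_def translated_def mid last 1 3 Suc_eq_plus1[symmetric] alt_Suc partial_sums.simps(1)
    by (rule key)
qed

section \<open>Almost everywhere classes of cochains\<close>

lemma ae_rel_trans:
  assumes "(f, f') \<in> ae_rel \<mu> n" "(f', f'') \<in> ae_rel \<mu> n"
  shows "(f, f'') \<in> ae_rel \<mu> n"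
proof -
  have "AE x in PiM {..<n} (\<lambda>_. \<mu>). f x = f' x" "AE x in PiM {..<n} (\<lambda>_. \<mu>). f' x = f'' x"
    using assms by (auto simp: ae_rel_def)
  then have "AE x in PiM {..<n} (\<lambda>_. \<mu>). f x = f'' x"
    by eventually_elim simp
  with assms show ?thesis by (auto simp: ae_rel_def)
qed

lemma ae_rel_sym: "(f, f') \<in> ae_rel \<mu> n \<Longrightarrow> (f', f) \<in> ae_rel \<mu> n"
  unfolding ae_rel_def by (auto elim!: eventually_mono)

lemma ae_rel_refl: "f \<in> borel_cochains n \<Longrightarrow> (f, f) \<in> ae_rel \<mu> n"
  by (simp add: ae_rel_def)

lemma ae_class_eq: "(f, f') \<in> ae_rel \<mu> n \<Longrightarrow> ae_class \<mu> n f = ae_class \<mu> n f'"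
  using ae_rel_trans ae_rel_sym by fast

lemma ae_class_eq_iff:
  "f' \<in> borel_cochains n \<Longrightarrow> ae_class \<mu> n f = ae_class \<mu> n f' \<longleftrightarrow> (f, f') \<in> ae_rel \<mu> n"
  using ae_class_eq[of f f' \<mu> n] ae_rel_refl[of f' n \<mu>] by blast

lemma ae_rel_add:
  assumes "(f, f') \<in> ae_rel \<mu> n" "(h, h') \<in> ae_rel \<mu> n"
  shows "((\<lambda>x. f x + h x), (\<lambda>x. f' x + h' x)) \<in> ae_rel \<mu> n"
proof -
  have "AE x in PiM {..<n} (\<lambda>_. \<mu>). f x = f' x" "AE x in PiM {..<n} (\<lambda>_. \<mu>). h x = h' x"
    using assms by (auto simp: ae_rel_def)
  then have "AE x in PiM {..<n} (\<lambda>_. \<mu>). f x + h x = f' x + h' x"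
    by eventually_elim simp
  with assms show ?thesis by (auto simp: ae_rel_def borel_cochains_def)
qed

lemma UN_eq_const: "a \<in> A \<Longrightarrow> (\<And>x. x \<in> A \<Longrightarrow> F x = C) \<Longrightarrow> (\<Union>x\<in>A. F x) = C"
  by auto

lemma mult_ae_class:
  assumes "f \<in> borel_cochains (nat p)" "h \<in> borel_cochains (nat p)"
  shows "mult (cochain_group \<mu> p) (ae_class \<mu> (nat p) f) (ae_class \<mu> (nat p) h)
    = ae_class \<mu> (nat p) (\<lambda>x. f x + h x)"
proof -
  have "ae_class \<mu> (nat p) (\<lambda>x. f' x + h' x) = ae_class \<mu> (nat p) (\<lambda>x. f x + h x)"
    if "f' \<in> ae_class \<mu> (nat p) f" "h' \<in> ae_class \<mu> (nat p) h" for f' h'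
    using that by (intro ae_class_eq ae_rel_add ae_rel_sym[of f f'] ae_rel_sym[of h h']) auto
  moreover have "f \<in> ae_class \<mu> (nat p) f" "h \<in> ae_class \<mu> (nat p) h"
    using assms by (auto intro: ae_rel_refl)
  ultimately have "(\<Union>f'\<in>ae_class \<mu> (nat p) f. \<Union>h'\<in>ae_class \<mu> (nat p) h. ae_class \<mu> (nat p) (\<lambda>x. f' x + h' x))
      = ae_class \<mu> (nat p) (\<lambda>x. f x + h x)"
    by (intro UN_eq_const)
  then show ?thesis
    by (simp only: cochain_group_def monoid.simps)
qed

lemma depends_first_comp: "depends_first n a \<Longrightarrow> depends_first n (\<lambda>x. h (a x))"
  by (rule depends_firstI) (drule depends_firstD, assumption, simp only:)

lemma depends_first_comp2:
  assumes "depends_first n a" "depends_first n b"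
  shows "depends_first n (\<lambda>x. h (a x) (b x))"
proof (rule depends_firstI)
  fix x y :: "nat \<Rightarrow> 'a" assume *: "\<And>i. i < n \<Longrightarrow> x i = y i"
  show "h (a x) (b x) = h (a y) (b y)"
    using depends_firstD[OF assms(1) *] depends_firstD[OF assms(2) *] by simp
qed

context haar_module
begin

lemma pred_eq_module [measurable (raw)]:
  fixes f g :: "'x \<Rightarrow> 'a"
  assumes [measurable]: "f \<in> borel_measurable M" "g \<in> borel_measurable M"
  shows "Measurable.pred M (\<lambda>x. f x = g x)"
proof -
  have "Measurable.pred M (\<lambda>x. f x + - g x = 0)" by measurable
  then show ?thesis by simp
qed

lemma cochain_of_seq:
  assumes "b \<in> borel_measurable seqs"
  shows "(\<lambda>g. b (partial_sums g)) \<in> borel_cochains n"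
  unfolding borel_cochains_def by (rule measurable_compose[OF measurable_partial_sums assms])

lemma seq_of_cochain:
  assumes "f \<in> borel_cochains n"
  shows "(\<lambda>x. f (increments n x)) \<in> borel_measurable seqs"
  using measurable_compose[OF measurable_increments] assms unfolding borel_cochains_def .

lemma coboundary_map_eq_face_cobd:
  "coboundary_map T n f g = face_cobd T n (\<lambda>x. f (increments n x)) (partial_sums g)"
proof -
  have "coboundary_map T n f g = coboundary_map T n (\<lambda>g. f (increments n (partial_sums g))) g"
    by (simp add: coboundary_map_def increments_partial_sums)
  also have "\<dots> = face_cobd T n (\<lambda>x. f (increments n x)) (partial_sums g)"
    by (rule coboundary_map_partial_sums[OF depends_first_increments])
  finally show ?thesis .
qed

lemma coboundary_map_cochain:
  assumes "f \<in> borel_cochains n"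
  shows "coboundary_map T n f \<in> borel_cochains (Suc n)"
  unfolding coboundary_map_eq_face_cobd[abs_def]
  by (intro cochain_of_seq face_cobd_measurable seq_of_cochain assms)

text \<open>
  The base face map is nonsingular: for a fixed base point it is a translation.
\<close>

lemma AE_translated:
  assumes [measurable]: "b \<in> borel_measurable seqs" "b' \<in> borel_measurable seqs"
    and "depends_first n b" "depends_first n b'" and eq: "\<And>m. AE x in S m. b x = b' x"
  shows "AE x in S m. translated T b x = translated T b' x"
proof (rule AE_case_nat_I)
  have dep: "depends_first n (\<lambda>x. b x = b' x)"
    by (rule depends_first_comp2[OF assms(3,4)])
  have "AE a in \<nu> m. a \<in> K m"
    unfolding \<nu>_def by (rule AE_uniform_measureI) auto
  then show "AE a in \<nu> m. AE x in S m. translated T b (case_nat a x) = translated T b' (case_nat a x)"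
  proof eventually_elim
    case (elim a)
    have "AE x in S m. b (\<lambda>j. - a + x j) = b' (\<lambda>j. - a + x j)"
      by (rule AE_S_translate[OF _ dep elim eq]) measurable
    then show ?case by eventually_elim (simp add: translated_def)
  qed
qed measurable

lemma AE_face_cobd:
  assumes "b \<in> borel_measurable seqs" "b' \<in> borel_measurable seqs"
    and "depends_first n b" "depends_first n b'" and eq: "\<And>m. AE x in S m. b x = b' x"
  shows "AE x in S m. face_cobd T n b x = face_cobd T n b' x"
proof -
  have "AE x in S m. \<forall>i. b (x \<circ> skip i) = b' (x \<circ> skip i)"
    unfolding AE_all_countable using AE_reindex[OF eq inj_skip] by blast
  then show ?thesis
    using AE_translated[OF assms, of m] by eventually_elim (simp only: face_cobd_def)
qed

lemma coboundary_map_ae_rel: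
  assumes "(f, f') \<in> ae_rel \<mu> n"
  shows "(coboundary_map T n f, coboundary_map T n f') \<in> ae_rel \<mu> (Suc n)"
proof -
  have f: "f \<in> borel_cochains n" "f' \<in> borel_cochains n" and ae: "AE x in PiM {..<n} (\<lambda>_. \<mu>). f x = f' x"
    using assms by (auto simp: ae_rel_def)
  let ?b = "\<lambda>x. f (increments n x)" and ?b' = "\<lambda>x. f' (increments n x)"
  note [measurable] = seq_of_cochain[OF f(1)] seq_of_cochain[OF f(2)]
  have dep: "depends_first n (\<lambda>x. ?b x = ?b' x)" by (rule depends_first_increments)
  have res: "restrict g {..<n} = g" if "g \<in> space (PiM {..<n} (\<lambda>_. \<mu>))" for g
    using that by (auto simp: space_PiM PiE_def extensional_restrict)
  have "AE g in PiM {..<n} (\<lambda>_. \<mu>). ?b (partial_sums g) = ?b' (partial_sums g)"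
    using ae AE_space by eventually_elim (simp add: increments_partial_sums res)
  then have eq: "AE x in S m. ?b x = ?b' x" for m
    by (subst (asm) AE_partial_sums_iff_S[OF _ dep]) auto
  have "AE x in S m. face_cobd T n ?b x = face_cobd T n ?b' x" for m
    by (rule AE_face_cobd[OF _ _ depends_first_increments depends_first_increments eq]) measurable
  then have "AE g in PiM {..<Suc n} (\<lambda>_. \<mu>). face_cobd T n ?b (partial_sums g) = face_cobd T n ?b' (partial_sums g)"
    using depends_first_comp2[OF depends_first_face_cobd[OF depends_first_increments[of n f], of T]
        depends_first_face_cobd[OF depends_first_increments[of n f'], of T], of "(=)"]
    by (subst AE_partial_sums_iff_S) auto
  then show ?thesis
    using f by (simp add: ae_rel_def coboundary_map_cochain coboundary_map_eq_face_cobd)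
qed

lemma coboundary_ae_class:
  assumes "f \<in> borel_cochains n"
  shows "coboundary \<mu> T (int n) (ae_class \<mu> n f) = ae_class \<mu> (Suc n) (coboundary_map T n f)"
proof -
  have "ae_class \<mu> (Suc n) (coboundary_map T n \<phi>) = ae_class \<mu> (Suc n) (coboundary_map T n f)"
    if "\<phi> \<in> ae_class \<mu> n f" for \<phi>
    using that by (intro ae_class_eq coboundary_map_ae_rel ae_rel_sym[of f]) auto
  moreover have "f \<in> ae_class \<mu> n f" using assms by (auto intro: ae_rel_refl)
  ultimately have "(\<Union>\<phi>\<in>ae_class \<mu> n f. ae_class \<mu> (Suc n) (coboundary_map T n \<phi>))
      = ae_class \<mu> (Suc n) (coboundary_map T n f)"
    by (intro UN_eq_const)
  moreover have "\<not> int n < 0" by simp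
  ultimately show ?thesis
    by (simp only: coboundary_def nat_int Suc_eq_plus1 if_False)
qed

lemma ae_class_cocycle_iff:
  assumes "f \<in> borel_cochains n"
  shows "ae_class \<mu> n f \<in> cocycles \<mu> T (int n) \<longleftrightarrow>
    (AE g in PiM {..<Suc n} (\<lambda>_. \<mu>). coboundary_map T n f g = 0)"
proof -
  have n: "nat (int n + 1) = Suc n" by simp
  have carr: "ae_class \<mu> n f \<in> carrier (cochain_group \<mu> (int n))"
    using assms by (auto simp: cochain_group_def quotient_def)
  have one: "one (cochain_group \<mu> (int n + 1)) = ae_class \<mu> (Suc n) (\<lambda>_. 0 :: 'a)"
    by (simp only: cochain_group_def monoid.simps n)
  have z: "(\<lambda>_ :: nat \<Rightarrow> 'g. 0 :: 'a) \<in> borel_cochains (Suc n)" by (simp add: borel_cochains_def)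
  have "ae_class \<mu> n f \<in> cocycles \<mu> T (int n) \<longleftrightarrow>
    ae_class \<mu> (Suc n) (coboundary_map T n f) = ae_class \<mu> (Suc n) (\<lambda>_. 0)"
    by (simp only: cocycles_def kernel_def mem_Collect_eq carr one coboundary_ae_class[OF assms] simp_thms)
  also have "\<dots> \<longleftrightarrow> (coboundary_map T n f, \<lambda>_. 0) \<in> ae_rel \<mu> (Suc n)"
    by (rule ae_class_eq_iff[OF z])
  also have "\<dots> \<longleftrightarrow> (AE g in PiM {..<Suc n} (\<lambda>_. \<mu>). coboundary_map T n f g = 0)"
    using z coboundary_map_cochain[OF assms] by (simp add: ae_rel_def)
  finally show ?thesis .
qed

lemma cohomology_class_coset:
  assumes "c \<in> carrier (cohomology \<mu> T p)"
  obtains X where "X \<in> cocycles \<mu> T p"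
    "c = (\<Union>h\<in>coboundaries \<mu> T p. {mult (cochain_group \<mu> p) h X})"
  using assms by (auto simp: cohomology_def FactGroup_def RCOSETS_def r_coset_def)

lemma cocycle_representative:
  assumes "X \<in> cocycles \<mu> T p"
  obtains f where "f \<in> borel_cochains (nat p)" "X = ae_class \<mu> (nat p) f"
proof -
  have X: "X \<in> carrier (cochain_group \<mu> p)" using assms by (simp add: cocycles_def kernel_def)
  show ?thesis
  proof (cases "p < 0")
    case True
    with X have "X = ae_class \<mu> (nat p) (\<lambda>_. 0)" by (simp add: cochain_group_def)
    then show ?thesis by (rule that[rotated]) (simp add: borel_cochains_def)
  next
    case False
    with X have "X \<in> borel_cochains (nat p) // ae_rel \<mu> (nat p)" by (simp add: cochain_group_def)
    then show ?thesis by (rule quotientE) (rule that)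
  qed
qed

text \<open>
  Almost all values of \<open>b'\<close> over a box lie in a compact set, but not all. So
  \<open>b'\<close> is set to zero where it leaves the compact set \<open>Q m\<close> belonging to
  some box \<open>K m\<close> around the point; this changes it on a null set, and bounds it
  everywhere.
\<close>

lemma locally_bounded_representative:
  assumes f: "f \<in> borel_cochains (Suc q)"
    and cocycle: "AE g in PiM {..<Suc (Suc q)} (\<lambda>_. \<mu>). coboundary_map T (Suc q) f g = 0"
  shows "\<exists>\<phi> \<sigma>. \<phi> \<in> borel_cochains q \<and>
    ((\<lambda>g. coboundary_map T q \<phi> g + f g), \<sigma>) \<in> ae_rel \<mu> (Suc q) \<and>
    (AE g in PiM {..<Suc (Suc q)} (\<lambda>_. \<mu>). coboundary_map T (Suc q) \<sigma> g = 0) \<and>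
    locally_totally_bounded (power_topology (Suc q)) \<sigma>"
proof -
  let ?p = "Suc q"
  define b where "b = (\<lambda>x. f (increments ?p x))"
  have b[measurable]: "b \<in> borel_measurable seqs"
    unfolding b_def by (rule seq_of_cochain[OF f])
  have dep: "depends_first ?p b" unfolding b_def by (rule depends_first_increments)
  have "depends_first (Suc ?p) (\<lambda>x. face_cobd T ?p b x = 0)"
    by (rule depends_first_comp[OF depends_first_face_cobd[OF dep]])
  then have coc: "AE x in S m. face_cobd T ?p b x = 0" for m
    using cocycle unfolding coboundary_map_eq_face_cobd b_def[symmetric]
    by (subst (asm) AE_partial_sums_iff_S) auto
  obtain \<phi> where \<phi>[measurable]: "\<phi> \<in> borel_measurable seqs" and dep\<phi>: "depends_first q \<phi>"
    and t: "tight ?p (\<lambda>x. b x + face_cobd T q \<phi> x)"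
    using cohomologous_tight[OF b dep coc, of ?p] by auto
  define b' where "b' x = b x + face_cobd T q \<phi> x" for x
  have b'[measurable]: "b' \<in> borel_measurable seqs" unfolding b'_def[abs_def] by measurable
  have dep': "depends_first ?p b'"
    unfolding b'_def[abs_def] by (rule depends_first_comp2[OF dep depends_first_face_cobd[OF dep\<phi>]])
  obtain Q where Q: "\<And>m. compact (Q m)" "\<And>m. AE x in S m. b' x \<in> Q m"
    using tight_bounded[OF t[folded b'_def] dep'] by blast
  have [measurable]: "Q m \<in> sets borel" for m by (intro borel_closed compact_imp_closed Q)
  define good where "good x \<longleftrightarrow> (\<forall>m. (\<forall>i<?p. x i \<in> K m) \<longrightarrow> b' x \<in> Q m)" for x
  have [measurable]: "Measurable.pred seqs good" unfolding good_def[abs_def] by measurable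
  have depgood: "depends_first ?p good"
  proof (rule depends_firstI)
    fix x y :: "nat \<Rightarrow> 'g" assume *: "\<And>i. i < ?p \<Longrightarrow> x i = y i"
    have "b' x = b' y" by (rule depends_firstD[OF dep' *])
    moreover have "(\<forall>i<?p. x i \<in> K m) \<longleftrightarrow> (\<forall>i<?p. y i \<in> K m)" for m
      by (intro all_cong1 imp_cong refl) (simp only: *)
    ultimately show "good x = good y" by (simp only: good_def)
  qed
  define s where "s x = (if good x then b' x else 0)" for x
  have s[measurable]: "s \<in> borel_measurable seqs" unfolding s_def[abs_def] by measurable
  have deps: "depends_first ?p s"
    unfolding s_def[abs_def]
    by (rule depends_first_comp2[OF depgood dep', where h = "\<lambda>P v. if P then v else 0"])
  have AEgood: "AE x in S m. good x" for m
  proof -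
    have "AE g in PiM {..<?p} (\<lambda>_. \<mu>). good g"
      unfolding good_def AE_all_countable
    proof
      fix m
      have "depends_first ?p (\<lambda>x. b' x \<in> Q m)" by (rule depends_first_comp[OF dep'])
      moreover have "Measurable.pred seqs (\<lambda>x. b' x \<in> Q m)" by measurable
      ultimately show "AE g in PiM {..<?p} (\<lambda>_. \<mu>). (\<forall>i<?p. g i \<in> K m) \<longrightarrow> b' g \<in> Q m"
        using Q(2)[of m] by (subst AE_PiM_box_iff_S) (simp_all add: measurable_PiM_of_depends depends_first_restrict[OF dep'])
    qed
    then show ?thesis
      by (subst (asm) AE_PiM_iff_S) (simp_all add: measurable_PiM_of_depends depgood depends_first_restrict[OF depgood])
  qed
  have eq: "AE x in S m. b' x = s x" for m
    using AEgood[of m] by eventually_elim (simp add: s_def)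
  define \<sigma> where "\<sigma> g = s (partial_sums g)" for g
  define \<phi>' where "\<phi>' g = \<phi> (partial_sums g)" for g
  have \<phi>': "\<phi>' \<in> borel_cochains q"
    unfolding \<phi>'_def[abs_def] by (rule cochain_of_seq) measurable
  have \<sigma>: "\<sigma> \<in> borel_cochains ?p"
    unfolding \<sigma>_def[abs_def] by (rule cochain_of_seq) measurable
  have cob\<phi>: "coboundary_map T q \<phi>' g = face_cobd T q \<phi> (partial_sums g)" for g
    unfolding \<phi>'_def[abs_def] by (rule coboundary_map_partial_sums[OF dep\<phi>])
  have cob\<sigma>: "coboundary_map T ?p \<sigma> g = face_cobd T ?p s (partial_sums g)" for g
    unfolding \<sigma>_def[abs_def] by (rule coboundary_map_partial_sums[OF deps])
  have "((\<lambda>g. coboundary_map T q \<phi>' g + f g), \<sigma>) \<in> ae_rel \<mu> ?p"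
  proof -
    have "depends_first ?p (\<lambda>x. b' x = s x)" by (rule depends_first_comp2[OF dep' deps])
    then have "AE g in PiM {..<?p} (\<lambda>_. \<mu>). b' (partial_sums g) = s (partial_sums g)"
      using eq by (subst AE_partial_sums_iff_S) auto
    then have "AE g in PiM {..<?p} (\<lambda>_. \<mu>). coboundary_map T q \<phi>' g + f g = \<sigma> g"
      using AE_space
    proof eventually_elim
      case (elim g)
      have "restrict g {..<?p} = g"
        using elim(2) by (auto simp: space_PiM PiE_def extensional_restrict)
      then have "b (partial_sums g) = f g" by (simp add: b_def increments_partial_sums)
      with elim(1) show ?case by (simp add: b'_def cob\<phi> \<sigma>_def add.commute)
    qed
    moreover have "(\<lambda>g. coboundary_map T q \<phi>' g + f g) \<in> borel_cochains ?p"
      using coboundary_map_cochain[OF \<phi>'] f unfolding borel_cochains_def by measurable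
    ultimately show ?thesis using \<sigma> by (simp add: ae_rel_def)
  qed
  moreover have "AE g in PiM {..<Suc ?p} (\<lambda>_. \<mu>). coboundary_map T ?p \<sigma> g = 0"
  proof -
    have "AE x in S m. face_cobd T ?p s x = 0" for m
      using AE_face_cobd[OF b' s dep' deps eq, of m] coc[of m]
    proof eventually_elim
      case (elim x)
      have "face_cobd T ?p b' x = face_cobd T ?p b x + face_cobd T ?p (face_cobd T q \<phi>) x"
        unfolding b'_def[abs_def] by (rule face_cobd_plus)
      with elim show ?case by (simp only: face_cobd_face_cobd) simp
    qed
    moreover have "depends_first (Suc ?p) (\<lambda>x. face_cobd T ?p s x = 0)"
      by (rule depends_first_comp[OF depends_first_face_cobd[OF deps]])
    ultimately show ?thesis
      unfolding cob\<sigma> by (subst AE_partial_sums_iff_S) auto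
  qed
  moreover have "locally_totally_bounded (power_topology ?p) \<sigma>"
    unfolding locally_totally_bounded_def
  proof (intro allI impI)
    fix L :: "(nat \<Rightarrow> 'g) set" assume L: "compactin (power_topology ?p) L"
    have "compact ((\<lambda>g. g i) ` L)" if "i < ?p" for i
    proof -
      have "continuous_map (power_topology ?p) euclidean (\<lambda>g. g i :: 'g)"
        unfolding power_topology_def using that by (intro continuous_map_product_projection) auto
      from image_compactin[OF L this] show ?thesis by simp
    qed
    then have "compact (\<Union>i<?p. (\<lambda>g. g i) ` L)" by (intro compact_UN) auto
    then obtain m where m: "(\<Union>i<?p. (\<lambda>g. g i) ` L) \<subseteq> K m"
      using K_exhausts by blast
    \<comment> \<open>Each summation moves up one step in the exhaustion.\<close>
    have ps: "partial_sums g i \<in> K (m + i)" if "g \<in> L" "i < ?p" for g i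
      using that(2)
    proof (induction i)
      case 0
      then show ?case using m that(1) by auto
    next
      case (Suc i)
      have "g (Suc i) \<in> K m" using m that(1) Suc.prems by auto
      then have "g (Suc i) \<in> K (m + i)" using K_mono[of m "m + i"] by auto
      with Suc show ?case using K_add[of "partial_sums g i" "m + i"] by auto
    qed
    have "partial_sums g i \<in> K (m + ?p)" if "g \<in> L" "i < ?p" for g i
      using ps[OF that] K_mono[of "m + i" "m + ?p"] that(2) by auto
    then have "\<sigma> ` L \<subseteq> insert 0 (Q (m + ?p))"
      by (auto simp: \<sigma>_def s_def good_def)
    moreover have c: "compact (insert 0 (Q (m + ?p)))" using Q(1) by (rule compact_insert)
    ultimately have "closure (\<sigma> ` L) \<subseteq> insert 0 (Q (m + ?p))"
      by (intro closure_minimal compact_imp_closed)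
    then show "compact (closure (\<sigma> ` L))"
      using compact_Int_closed[OF c closed_closure[of "\<sigma> ` L"]] by (simp add: Int_absorb1)
  qed
  ultimately show ?thesis using \<phi>' by blast
qed

end

section \<open>Compact exhaustions of the group\<close>

lemma ex_compact_exhaustion:
  assumes lc: "locally_compact_space (euclidean :: 'g::{topological_group_add, t2_space, second_countable_topology} topology)"
  shows "\<exists>B :: nat \<Rightarrow> 'g set. (\<forall>n. compact (B n)) \<and> (\<forall>Q. compact Q \<longrightarrow> (\<exists>N. Q \<subseteq> (\<Union>n\<le>N. B n)))"
proof -
  define \<U> where "\<U> = {U :: 'g set. open U \<and> (\<exists>C. compact C \<and> U \<subseteq> C)}"
  have "\<And>U. U \<in> \<U> \<Longrightarrow> open U" by (simp add: \<U>_def)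
  from Lindelof[OF this] obtain \<V> where \<V>: "\<V> \<subseteq> \<U>" "countable \<V>" "\<Union>\<V> = \<Union>\<U>"
    by blast
  have cover: "\<Union>\<U> = UNIV"
  proof -
    have "x \<in> \<Union>\<U>" for x :: 'g
      using lc unfolding locally_compact_space_def \<U>_def by fastforce
    then show ?thesis by blast
  qed
  then have "\<V> \<noteq> {}" using \<V>(3) by auto
  have "\<forall>U\<in>\<V>. \<exists>C. compact C \<and> U \<subseteq> C" using \<V>(1) by (auto simp: \<U>_def)
  then obtain C where C: "\<And>U. U \<in> \<V> \<Longrightarrow> compact (C U)" "\<And>U. U \<in> \<V> \<Longrightarrow> U \<subseteq> C U"
    by metis
  define V where "V = from_nat_into \<V>"
  have V: "V n \<in> \<V>" for n
    unfolding V_def by (rule from_nat_into) fact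
  have rangeV: "range V = \<V>"
    unfolding V_def by (rule range_from_nat_into) fact+
  have "\<exists>N. Q \<subseteq> (\<Union>n\<le>N. C (V n))" if Qc: "compact Q" for Q
  proof -
    have Q: "Q \<subseteq> \<Union>(V ` UNIV)" using rangeV \<V>(3) cover by auto
    have op: "open (V n)" for n using V \<V>(1) by (auto simp: \<U>_def)
    obtain F where F: "finite F" "Q \<subseteq> (\<Union>n\<in>F. V n)"
      by (rule compactE_image[OF Qc op Q])
    then have "Q \<subseteq> (\<Union>n\<le>Max (insert 0 F). C (V n))"
      using C(2)[OF V] by (fastforce intro: Max_ge)
    then show ?thesis by blast
  qed
  then show ?thesis using C(1)[OF V] by (intro exI[of _ "\<lambda>n. C (V n)"]) auto
qed

text \<open>
  Starting from a compact set of positive measure, \<open>K\<close> is enlarged by the next compact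
  set and by sums and differences. Zero is put in so that the sets increase.
\<close>

lemma ex_haar_exhaustion:
  fixes \<mu> :: "'g::{topological_group_add, t2_space, second_countable_topology} measure"
  assumes lc: "locally_compact_space (euclidean :: 'g topology)" and haar: "left_haar_measure \<mu>"
  shows "\<exists>K. haar_exhaustion \<mu> K"
proof -
  obtain B :: "nat \<Rightarrow> 'g set" where B: "\<And>n. compact (B n)" "\<And>Q. compact Q \<Longrightarrow> \<exists>N. Q \<subseteq> (\<Union>n\<le>N. B n)"
    using ex_compact_exhaustion[OF lc] by blast
  have sets: "sets \<mu> = sets borel" using haar by (simp add: left_haar_measure_def)
  have B_sets: "B n \<in> sets \<mu>" for n
    unfolding sets by (intro borel_closed compact_imp_closed B)
  have UN: "(\<Union>n. B n) = UNIV"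
    using B(2)[of "{_}"] by fastforce
  obtain n0 where n0: "emeasure \<mu> (B n0) \<noteq> 0"
  proof (rule ccontr)
    assume "\<not> thesis"
    then have "\<And>n. emeasure \<mu> (B n) = 0" using that by blast
    then have "emeasure \<mu> (\<Union>n. B n) = 0" using B_sets by (intro emeasure_UN_eq_0) auto
    with UN haar show False by (simp add: left_haar_measure_def)
  qed
  define step where "step n P = (let P' = insert 0 (P \<union> B n) in
     (\<lambda>(a, b). a + b) ` (P' \<times> P') \<union> (\<lambda>(a, b). - a + b) ` (P' \<times> P'))" for n P
  define K where "K = rec_nat (insert 0 (B n0)) step"
  have K0: "K 0 = insert 0 (B n0)" and KS: "K (Suc n) = step n (K n)" for n
    by (simp_all add: K_def)
  have in_step: "insert 0 (P \<union> B n) \<subseteq> step n P" for n P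
  proof
    fix x assume x: "x \<in> insert 0 (P \<union> B n)"
    then have "(\<lambda>(a, b). a + b) (0, x) \<in> step n P"
      unfolding step_def Let_def by (intro UnI1 imageI) auto
    then show "x \<in> step n P" by simp
  qed
  have "compact (step n P)" if "compact P" for n P
    unfolding step_def Let_def split_def
    by (intro compact_Un compact_continuous_image compact_Times compact_insert that B continuous_intros)
  then have K: "compact (K n)" for n
    by (induction n) (auto simp: K0 KS B)
  have mono: "K n \<subseteq> K (Suc n)" for n using in_step[of "K n" n] by (auto simp: KS)
  have K_mono: "K m \<subseteq> K n" if "m \<le> n" for m n
    by (rule lift_Suc_mono_le[OF _ that, of K]) (rule mono)
  show ?thesis
  proof (intro exI[of _ K], unfold_locales)
    show "left_haar_measure \<mu>" by fact
    show "compact (K m)" "K m \<subseteq> K (Suc m)" for m by (rule K mono)+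
    show "a + b \<in> K (Suc m)" "- a + b \<in> K (Suc m)" if "a \<in> K m" "b \<in> K m" for a b m
    proof -
      have ab: "(a, b) \<in> insert 0 (K m \<union> B m) \<times> insert 0 (K m \<union> B m)" using that by auto
      show "a + b \<in> K (Suc m)" "- a + b \<in> K (Suc m)"
        unfolding KS step_def Let_def
        by (rule UnI1, rule image_eqI[OF _ ab], simp) (rule UnI2, rule image_eqI[OF _ ab], simp)
    qed
    show "emeasure \<mu> (K m) \<noteq> 0" for m
    proof -
      have "B n0 \<subseteq> K m" using K_mono[of 0 m] by (auto simp: K0)
      then have "emeasure \<mu> (B n0) \<le> emeasure \<mu> (K m)"
        by (rule emeasure_mono) (auto simp: sets intro: borel_closed compact_imp_closed K)
      with n0 show ?thesis by auto
    qed
    show "\<exists>m. Q \<subseteq> K m" if Q: "compact Q" for Q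
    proof -
      obtain N where N: "Q \<subseteq> (\<Union>n\<le>N. B n)" using B(2)[OF Q] by blast
      have "B n \<subseteq> K (Suc N)" if "n \<le> N" for n
        using in_step[of "K n" n] K_mono[of "Suc n" "Suc N"] that by (auto simp: KS)
      with N have "Q \<subseteq> K (Suc N)" by blast
      then show ?thesis by blast
    qed
  qed
qed

context haar_module
begin

text \<open>
  In degree at most zero a cochain lives on a one-point space, where there is nothing to improve.
\<close>

lemma class_has_locally_bounded_representative:
  assumes "c \<in> carrier (cohomology \<mu> T p)"
  shows "\<exists>\<sigma> \<in> borel_cochains (nat p). ae_class \<mu> (nat p) \<sigma> \<in> cocycles \<mu> T p \<and>
     ae_class \<mu> (nat p) \<sigma> \<in> c \<and> locally_totally_bounded (power_topology (nat p)) \<sigma>"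
proof -
  obtain X where X: "X \<in> cocycles \<mu> T p" and c: "c = (\<Union>h\<in>coboundaries \<mu> T p. {mult (cochain_group \<mu> p) h X})"
    using cohomology_class_coset[OF assms] by blast
  obtain f where f: "f \<in> borel_cochains (nat p)" and Xf: "X = ae_class \<mu> (nat p) f"
    using cocycle_representative[OF X] by blast
  show ?thesis
  proof (cases "p \<le> 0")
    case True
    then have p: "nat p = 0" by simp
    have z: "(\<lambda>_ :: nat \<Rightarrow> 'g. 0 :: 'a) \<in> borel_cochains (nat p)" by (simp add: borel_cochains_def)
    have "ae_class \<mu> 0 (\<lambda>_. 0) \<in> carrier (cochain_group \<mu> (p - 1))"
      using True by (simp add: cochain_group_def)
    moreover have "coboundary \<mu> T (p - 1) (ae_class \<mu> 0 (\<lambda>_. 0)) = ae_class \<mu> (nat p) (\<lambda>_. 0)"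
      using True by (simp add: coboundary_def cochain_group_def)
    ultimately have "ae_class \<mu> (nat p) (\<lambda>_. 0) \<in> coboundaries \<mu> T p"
      unfolding coboundaries_def by (metis imageI)
    moreover have "mult (cochain_group \<mu> p) (ae_class \<mu> (nat p) (\<lambda>_. 0)) X = X"
      unfolding Xf by (subst mult_ae_class[OF z f]) simp
    ultimately have "X \<in> c" unfolding c by (metis UN_I singletonI)
    moreover have "locally_totally_bounded (power_topology (nat p)) f"
      unfolding locally_totally_bounded_def
    proof (intro allI impI)
      fix L :: "(nat \<Rightarrow> 'g) set" assume "compactin (power_topology (nat p)) L"
      then have "L \<subseteq> topspace (power_topology (nat p))" by (rule compactin_subset_topspace)
      also have "\<dots> = {\<lambda>_. undefined}" by (simp add: power_topology_def p)
      finally have "finite (f ` L)" by (meson finite.emptyI finite_imageI finite_insert finite_subset)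
      then show "compact (closure (f ` L))" by (simp add: finite_imp_compact finite_imp_closed)
    qed
    ultimately show ?thesis using f X unfolding Xf by blast
  next
    case False
    then obtain q where q: "nat p = Suc q" using gr0_implies_Suc[of "nat p"] by auto
    then have p: "p = int (Suc q)" "p - 1 = int q" by auto
    have f': "f \<in> borel_cochains (Suc q)" using f by (simp only: q)
    have "AE g in PiM {..<Suc (Suc q)} (\<lambda>_. \<mu>). coboundary_map T (Suc q) f g = 0"
      using X unfolding Xf q unfolding p(1) ae_class_cocycle_iff[OF f'] .
    from locally_bounded_representative[OF f' this] obtain \<phi> \<sigma> where \<phi>: "\<phi> \<in> borel_cochains q"
      and eq: "((\<lambda>g. coboundary_map T q \<phi> g + f g), \<sigma>) \<in> ae_rel \<mu> (Suc q)"
      and coc: "AE g in PiM {..<Suc (Suc q)} (\<lambda>_. \<mu>). coboundary_map T (Suc q) \<sigma> g = 0"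
      and ltb: "locally_totally_bounded (power_topology (Suc q)) \<sigma>"
      by blast
    have \<sigma>: "\<sigma> \<in> borel_cochains (Suc q)" using eq by (simp add: ae_rel_def)
    have "ae_class \<mu> q \<phi> \<in> carrier (cochain_group \<mu> (p - 1))"
      using \<phi> by (auto simp: p(2) cochain_group_def quotient_def)
    then have "coboundary \<mu> T (p - 1) (ae_class \<mu> q \<phi>) \<in> coboundaries \<mu> T p"
      unfolding coboundaries_def by (rule imageI)
    then have "ae_class \<mu> (nat p) (coboundary_map T q \<phi>) \<in> coboundaries \<mu> T p"
      by (simp only: p(2) q coboundary_ae_class[OF \<phi>])
    moreover have "mult (cochain_group \<mu> p) (ae_class \<mu> (nat p) (coboundary_map T q \<phi>)) X = ae_class \<mu> (nat p) \<sigma>"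
      unfolding Xf
      by (subst mult_ae_class) (use coboundary_map_cochain[OF \<phi>] f ae_class_eq[OF eq] in \<open>simp_all only: q\<close>)
    ultimately have "ae_class \<mu> (nat p) \<sigma> \<in> c" unfolding c by (metis UN_I singletonI)
    moreover have "ae_class \<mu> (nat p) \<sigma> \<in> cocycles \<mu> T p"
      unfolding q unfolding p(1) ae_class_cocycle_iff[OF \<sigma>] by (rule coc)
    ultimately show ?thesis using \<sigma> ltb by (auto simp only: q)
  qed
qed

end

theorem proposition3p3:
  fixes \<mu> :: "'g::{topological_group_add, t2_space, second_countable_topology} measure"
    and T :: "'g \<Rightarrow> 'a::{polish_space, topological_ab_group_add} \<Rightarrow> 'a"
    and p :: int
    and c :: "((nat \<Rightarrow> 'g) \<Rightarrow> 'a) set set"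
  assumes "locally_compact_space (euclidean :: 'g topology)"
    and "left_haar_measure \<mu>"
    and "polish_module T"
    and "c \<in> carrier (cohomology \<mu> T p)"
  shows "\<exists>\<sigma> \<in> borel_cochains (nat p).
           ae_class \<mu> (nat p) \<sigma> \<in> cocycles \<mu> T p \<and>
           ae_class \<mu> (nat p) \<sigma> \<in> c \<and>
           locally_totally_bounded (power_topology (nat p)) \<sigma>"
proof -
  obtain K where "haar_exhaustion \<mu> K"
    using ex_haar_exhaustion[OF assms(1,2)] by blast
  then interpret haar_exhaustion \<mu> K .
  interpret haar_module \<mu> K T
    using assms(3) by unfold_locales (auto simp: polish_module_def)
  show ?thesis by (rule class_has_locally_bounded_representative[OF assms(4)])
qed

end
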